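(* Let $q$ be a primitive cube root of unity, $\mathfrak{q}=\left(\begin{smallmatrix} q & q \\ q & q \end{smallmatrix}\right)$, and $\boldsymbol\lambda=(\lambda_1,\lambda_2,\lambda_{12},\lambda_{112},\lambda_{122})$ (see context). The linear map $\gamma_{\boldsymbol\lambda}\colon\mathfrak{B}_{\mathfrak{q}}\to\mathcal{E}_{\boldsymbol\lambda}$ given on the PBW basis ($0\le n_2,n_{12},n_1\le2$) by $$\gamma_{\boldsymbol\lambda}(x_2^{n_2}x_{12}^{n_{12}}x_1^{n_1})=y_2^{n_2}y_{12}^{n_{12}}y_1^{n_1}-(\epsilon_0\otimes\ell)(\pi_{\mathcal{E}}\tau_2\otimes\pi_{\mathfrak{B}})\underline{\Delta}(x_2^{n_2}x_{12}^{n_{12}}x_1^{n_1}),$$ where on the right-hand side $x_2^{n_2}x_{12}^{n_{12}}x_1^{n_1}$ is regarded in $T(V)$, is a section in $H$-mod (an $H$-linear, convolution-invertible isomorphism of right $\mathfrak{B}_{\mathfrak{q}}$-comodules with $\gamma_{\boldsymbol\lambda}(1)=1$) such that $\epsilon_0\gamma_{\boldsymbol\lambda}=\epsilon$. Explicitly, writing $\gamma=\gamma_{\boldsymbol\lambda}$: \begin{align*} \gamma(x_{12}^2)&=y_{12}^2-(q^2-q)\lambda_{112}y_2,\\ \gamma(x_{12}^2x_1)&=y_{12}^2y_1+3q^2\lambda_1y_2^2-(q^2-q)\lambda_{112}y_2y_1,\\ \gamma(x_{12}x_1^2)&=y_{12}y_1^2-(q^2-q)\lambda_1y_2,\\ \gamma(x_2x_{12}^2)&=y_2y_{12}^2-(q^2-q)\lambda_{112}y_2^2,\\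 \gamma(x_2x_{12}x_1^2)&=y_2y_{12}y_1^2-(q^2-q)\lambda_1y_2^2,\\ \gamma(x_2x_{12}^2x_1)&=y_2y_{12}^2y_1-(q^2-q)\lambda_{112}y_2^2y_1,\\ \gamma(x_{12}^2x_1^2)&=y_{12}^2y_1^2-3q\lambda_1y_2^2y_1-(q-q^2)\lambda_1y_2y_{12}-(q^2-q)\lambda_{112}y_2y_1^2,\\ \gamma(x_2x_{12}^2x_1^2)&=y_2y_{12}^2y_1^2-(q-q^2)\lambda_1y_2^2y_{12}-(q^2-q)\lambda_{112}y_2^2y_1^2, \end{align*} and $\gamma(x_2^{n_2}x_{12}^{n_{12}}x_1^{n_1})=y_2^{n_2}y_{12}^{n_{12}}y_1^{n_1}$ in all other cases.
   Context: $\Bbbk$ is algebraically closed of characteristic zero. $H$ is a semisimple Hopf algebra with a principal YD-realization of $\mathfrak{q}$: pairs $(g_i,\chi_i)$, $i=1,2$, of a group-like $g_i\in H$ and an algebra map $\chi_i\colon H\to\Bbbk$ with $\chi_i(h)g_i=\chi_i(h_{(2)})h_{(1)}g_i\mathcal{S}(h_{(3)})$ for $h\in H$ and $\chi_j(g_i)=q$ for all $i,j$. $V$ has basis $x_1,x_2$ and is a Yetter–Drinfeld module via $h\cdot x_i=\chi_i(h)x_i$, $x_i\mapsto g_i\otimes x_i$. Its Nichols algebra $\mathfrak{B}_{\mathfrak{q}}$ is generated by $x_1,x_2$ with relations $x_1^3=x_2^3=x_{12}^3=0$, $x_{112}=x_{122}=0$, where $x_{12}=x_1x_2-qx_2x_1$,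 $x_{112}=x_1x_{12}-q^2x_{12}x_1$, $x_{122}=x_{12}x_2-q^2x_2x_{12}$; PBW basis $\{x_2^{n_2}x_{12}^{n_{12}}x_1^{n_1}:0\le n_2,n_{12},n_1\le2\}$. $\mathcal{E}_{\boldsymbol\lambda}$ is the algebra generated by $y_1,y_2$ with relations $y_1^3=\lambda_1$, $y_2^3=\lambda_2$, $y_{12}^3=\lambda_{12}$, $y_{112}=\lambda_{112}$, $y_{122}=\lambda_{122}$ (with $y_{12},y_{112},y_{122}$ defined as for the $x$'s), where $\lambda_i\ne0$ only if $\chi_i^3=\epsilon$, $\lambda_{12}\ne0$ only if $(\chi_1\chi_2)^3=\epsilon$, $\lambda_{112}\ne0$ only if $\chi_1^2\chi_2=\epsilon$, $\lambda_{122}\ne0$ only if $\chi_1\chi_2^2=\epsilon$. It is an $H$-module algebra via $h\cdot y_i=\chi_i(h)y_i$, and a right $\mathfrak{B}_{\mathfrak{q}}$-comodule algebra with coaction $\rho$ the algebra map with $\rho(y_i)=y_i\otimes1+1\otimes x_i$ (braided tensor product: $(e\otimes b)(e'\otimes b')=e(b_{(-1)}\cdot e')\otimes b_{(0)}b'$). It is known that $\mathcal{E}_{\boldsymbol\lambda}$ is a cleft object for $\mathfrak{B}_{\mathfrak{q}}$ in $H$-mod with basis $\{y_2^{n_2}y_{12}^{n_{12}}y_1^{n_1}:0\le n_2,n_{12},n_1\le2\}$. Notation: $\ell\colon\mathfrak{B}_{\mathfrak{q}}\to\mathcal{E}_{\boldsymbol\lambda}$ is the linear isomorphism $x_2^{n_2}x_{12}^{n_{12}}x_1^{n_1}\mapsto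 y_2^{n_2}y_{12}^{n_{12}}y_1^{n_1}$ on the bases; $\epsilon_0\colon\mathcal{E}_{\boldsymbol\lambda}\to\Bbbk$ is linear with $\epsilon_0\ell=\epsilon_{\mathfrak{B}_{\mathfrak{q}}}$; $\pi_{\mathfrak{B}}\colon T(V)\to\mathfrak{B}_{\mathfrak{q}}$ and $\pi_{\mathcal{E}}\colon T(V)\to\mathcal{E}_{\boldsymbol\lambda}$ are the algebra projections $x_i\mapsto x_i$, $x_i\mapsto y_i$; $\tau_2$ is the linear projection of $T(V)$ onto $\ker\pi_{\mathfrak{B}}$ along the span of the elements $x_2^{n_2}x_{12}^{n_{12}}x_1^{n_1}\in T(V)$, $0\le n_2,n_{12},n_1\le2$; $\underline{\Delta}(a)=\Delta(a)-a\otimes1-1\otimes a$ for homogeneous $a\in T(V)$ of positive degree and $\underline{\Delta}=0$ in degree 0, $\Delta$ being the braided coproduct of $T(V)$ with $x_i$ primitive. *)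

theory Defs
  imports
    "HOL-Library.Poly_Mapping"
    "HOL-Computational_Algebra.Polynomial"
begin

definition k_algebra :: "('k::field \<Rightarrow> 'a::ring_1 \<Rightarrow> 'a) \<Rightarrow> bool" where
  "k_algebra s \<longleftrightarrow> vector_space s \<and>
     (\<forall>c a b. s c (a * b) = s c a * b \<and> s c (a * b) = a * s c b)"

definition algebra_map ::
  "('k::field \<Rightarrow> 'a::ring_1 \<Rightarrow> 'a) \<Rightarrow> ('k \<Rightarrow> 'b::ring_1 \<Rightarrow> 'b) \<Rightarrow> ('a \<Rightarrow> 'b) \<Rightarrow> bool" where
  "algebra_map sA sB f \<longleftrightarrow> Vector_Spaces.linear sA sB f \<and> f 1 = 1 \<and> (\<forall>a b. f (a * b) = f a * f b)"

definition left_ideal :: "'a::ring_1 set \<Rightarrow> bool" where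
  "left_ideal I \<longleftrightarrow> 0 \<in> I \<and> (\<forall>a\<in>I. \<forall>b\<in>I. a + b \<in> I) \<and> (\<forall>r. \<forall>a\<in>I. r * a \<in> I)"

text \<open>Semisimplicity of the left regular module: every submodule is a direct summand.\<close>

definition semisimple_ring :: "'a::ring_1 itself \<Rightarrow> bool" where
  "semisimple_ring _ \<longleftrightarrow>
     (\<forall>I::'a set. left_ideal I \<longrightarrow>
        (\<exists>J. left_ideal J \<and> I \<inter> J = {0} \<and> (\<forall>r. \<exists>a\<in>I. \<exists>b\<in>J. r = a + b)))"

definition two_sided_ideal :: "'a::ring_1 set \<Rightarrow> bool" where
  "two_sided_ideal I \<longleftrightarrow>
     0 \<in> I \<and> (\<forall>a\<in>I. \<forall>b\<in>I. a + b \<in> I) \<and> (\<forall>r. \<forall>a\<in>I. r * a \<in> I \<and> a * r \<in> I)"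

definition ideal_generated :: "'a::ring_1 set \<Rightarrow> 'a set" where
  "ideal_generated R = \<Inter>{I. two_sided_ideal I \<and> R \<subseteq> I}"

definition projection_onto_along ::
  "('k::field \<Rightarrow> 'a::ab_group_add \<Rightarrow> 'a) \<Rightarrow> ('a \<Rightarrow> 'a) \<Rightarrow> 'a set \<Rightarrow> 'a set \<Rightarrow> bool" where
  "projection_onto_along s p K W \<longleftrightarrow>
     Vector_Spaces.linear s s p \<and> range p = K \<and> (\<forall>v\<in>K. p v = v) \<and> {v. p v = 0} = W"

text \<open>
  An element of \<open>A \<otimes> B\<close> is written as a finite sum of pure tensors, that is, as a list of pairs;
  a scalar factor is absorbed into one of the components, and concatenation is addition. Two lists
  denote the same tensor iff they are related by \<open>tensor_eq\<close>, the congruence that presents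
  \<open>A \<otimes> B\<close> as a commutative monoid (it is a group, since \<open>(a, b) + (- a, b) = (0, b) = 0\<close>) by the
  generators \<open>(a, b)\<close> and the biadditivity and balancedness relations. A map into a tensor product
  is a choice of a representing list for each of its values (Sweedler notation), and identities
  between such maps are stated modulo \<open>tensor_eq\<close>.
\<close>

inductive tensor_eq ::
  "('k::field \<Rightarrow> 'a::ab_group_add \<Rightarrow> 'a) \<Rightarrow> ('k \<Rightarrow> 'b::ab_group_add \<Rightarrow> 'b) \<Rightarrow>
   ('a \<times> 'b) list \<Rightarrow> ('a \<times> 'b) list \<Rightarrow> bool"
  for sA sB where
  refl: "tensor_eq sA sB u u"
| sym: "tensor_eq sA sB u v \<Longrightarrow> tensor_eq sA sB v u"
| trans: "tensor_eq sA sB u v \<Longrightarrow> tensor_eq sA sB v w \<Longrightarrow> tensor_eq sA sB u w"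
| append: "tensor_eq sA sB u u' \<Longrightarrow> tensor_eq sA sB v v' \<Longrightarrow> tensor_eq sA sB (u @ v) (u' @ v')"
| comm: "tensor_eq sA sB (u @ v) (v @ u)"
| zero: "tensor_eq sA sB [(0, b)] []"
| add_left: "tensor_eq sA sB [(a + a', b)] [(a, b), (a', b)]"
| add_right: "tensor_eq sA sB [(a, b + b')] [(a, b), (a, b')]"
| balanced: "tensor_eq sA sB [(sA c a, b)] [(a, sB c b)]"

inductive tensor3_eq ::
  "('k::field \<Rightarrow> 'a::ab_group_add \<Rightarrow> 'a) \<Rightarrow> ('k \<Rightarrow> 'b::ab_group_add \<Rightarrow> 'b) \<Rightarrow>
   ('k \<Rightarrow> 'c::ab_group_add \<Rightarrow> 'c) \<Rightarrow>
   ('a \<times> 'b \<times> 'c) list \<Rightarrow> ('a \<times> 'b \<times> 'c) list \<Rightarrow> bool"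
  for sA sB sC where
  refl: "tensor3_eq sA sB sC u u"
| sym: "tensor3_eq sA sB sC u v \<Longrightarrow> tensor3_eq sA sB sC v u"
| trans: "tensor3_eq sA sB sC u v \<Longrightarrow> tensor3_eq sA sB sC v w \<Longrightarrow> tensor3_eq sA sB sC u w"
| append: "tensor3_eq sA sB sC u u' \<Longrightarrow> tensor3_eq sA sB sC v v' \<Longrightarrow>
    tensor3_eq sA sB sC (u @ v) (u' @ v')"
| comm: "tensor3_eq sA sB sC (u @ v) (v @ u)"
| zero: "tensor3_eq sA sB sC [(0, b, c)] []"
| add1: "tensor3_eq sA sB sC [(a + a', b, c)] [(a, b, c), (a', b, c)]"
| add2: "tensor3_eq sA sB sC [(a, b + b', c)] [(a, b, c), (a, b', c)]"
| add3: "tensor3_eq sA sB sC [(a, b, c + c')] [(a, b, c), (a, b, c')]"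
| balanced12: "tensor3_eq sA sB sC [(sA r a, b, c)] [(a, sB r b, c)]"
| balanced23: "tensor3_eq sA sB sC [(a, sB r b, c)] [(a, b, sC r c)]"

definition tensor_linear ::
  "('k::field \<Rightarrow> 'a::ab_group_add \<Rightarrow> 'a) \<Rightarrow> ('k \<Rightarrow> 'b::ab_group_add \<Rightarrow> 'b) \<Rightarrow>
   ('k \<Rightarrow> 'c::ab_group_add \<Rightarrow> 'c) \<Rightarrow> ('a \<Rightarrow> ('b \<times> 'c) list) \<Rightarrow> bool" where
  "tensor_linear sA sB sC f \<longleftrightarrow>
     (\<forall>a a'. tensor_eq sB sC (f (a + a')) (f a @ f a')) \<and>
     (\<forall>r a. tensor_eq sB sC (f (sA r a)) (map (\<lambda>(b, c). (sB r b, c)) (f a)))"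

definition tensor_map :: "('a \<Rightarrow> 'c) \<Rightarrow> ('b \<Rightarrow> 'd) \<Rightarrow> ('a \<times> 'b) list \<Rightarrow> ('c \<times> 'd) list" where
  "tensor_map f g u = map (\<lambda>(a, b). (f a, g b)) u"

definition tensor_lift :: "('a \<Rightarrow> 'b \<Rightarrow> 'c::comm_monoid_add) \<Rightarrow> ('a \<times> 'b) list \<Rightarrow> 'c" where
  "tensor_lift \<beta> u = (\<Sum>(a, b)\<leftarrow>u. \<beta> a b)"

definition tensor_mult ::
  "('a::times \<times> 'b::times) list \<Rightarrow> ('a \<times> 'b) list \<Rightarrow> ('a \<times> 'b) list" where
  "tensor_mult u v = [(a * a', b * b'). (a, b) \<leftarrow> u, (a', b') \<leftarrow> v]"

record ('k, 'h) hopf =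
  scal :: "'k \<Rightarrow> 'h \<Rightarrow> 'h"
  comult :: "'h \<Rightarrow> ('h \<times> 'h) list"
  counit :: "'h \<Rightarrow> 'k"
  antipode :: "'h \<Rightarrow> 'h"

definition comult2 :: "('k, 'h) hopf \<Rightarrow> 'h \<Rightarrow> ('h \<times> 'h \<times> 'h) list" where
  "comult2 H h = [(h1, h2, h3). (h1, t) \<leftarrow> comult H h, (h2, h3) \<leftarrow> comult H t]"

definition hopf_algebra :: "('k::field, 'h::ring_1) hopf \<Rightarrow> bool" where
  "hopf_algebra H \<longleftrightarrow>
     k_algebra (scal H) \<and>
     tensor_linear (scal H) (scal H) (scal H) (comult H) \<and>
     tensor_eq (scal H) (scal H) (comult H 1) [(1, 1)] \<and>
     (\<forall>a b. tensor_eq (scal H) (scal H) (comult H (a * b)) (tensor_mult (comult H a) (comult H b))) \<and>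
     (\<forall>h. tensor3_eq (scal H) (scal H) (scal H)
            [(h1, h2, h3). (t, h3) \<leftarrow> comult H h, (h1, h2) \<leftarrow> comult H t] (comult2 H h)) \<and>
     algebra_map (scal H) (*) (counit H) \<and>
     (\<forall>h. (\<Sum>(h1, h2)\<leftarrow>comult H h. scal H (counit H h1) h2) = h) \<and>
     (\<forall>h. (\<Sum>(h1, h2)\<leftarrow>comult H h. scal H (counit H h2) h1) = h) \<and>
     Vector_Spaces.linear (scal H) (scal H) (antipode H) \<and>
     (\<forall>h. (\<Sum>(h1, h2)\<leftarrow>comult H h. antipode H h1 * h2) = scal H (counit H h) 1) \<and>
     (\<forall>h. (\<Sum>(h1, h2)\<leftarrow>comult H h. h1 * antipode H h2) = scal H (counit H h) 1)"

definition group_like :: "('k::field, 'h::ring_1) hopf \<Rightarrow> 'h \<Rightarrow> bool" where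
  "group_like H g \<longleftrightarrow> tensor_eq (scal H) (scal H) (comult H g) [(g, g)] \<and> counit H g = 1"

definition conv :: "('k::field, 'h) hopf \<Rightarrow> ('h \<Rightarrow> 'k) \<Rightarrow> ('h \<Rightarrow> 'k) \<Rightarrow> 'h \<Rightarrow> 'k" where
  "conv H \<phi> \<psi> h = (\<Sum>(h1, h2)\<leftarrow>comult H h. \<phi> h1 * \<psi> h2)"

fun conv_power :: "('k::field, 'h) hopf \<Rightarrow> ('h \<Rightarrow> 'k) \<Rightarrow> nat \<Rightarrow> 'h \<Rightarrow> 'k" where
  "conv_power H \<phi> 0 = counit H"
| "conv_power H \<phi> (Suc n) = conv H \<phi> (conv_power H \<phi> n)"

definition module_algebra ::
  "('k::field, 'h::ring_1) hopf \<Rightarrow> ('k \<Rightarrow> 'a::ring_1 \<Rightarrow> 'a) \<Rightarrow> ('h \<Rightarrow> 'a \<Rightarrow> 'a) \<Rightarrow> bool" where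
  "module_algebra H s act \<longleftrightarrow>
     (\<forall>a. Vector_Spaces.linear (scal H) s (\<lambda>h. act h a)) \<and>
     (\<forall>h. Vector_Spaces.linear s s (act h)) \<and>
     (\<forall>a. act 1 a = a) \<and>
     (\<forall>h h' a. act (h * h') a = act h (act h' a)) \<and>
     (\<forall>h. act h 1 = s (counit H h) 1) \<and>
     (\<forall>h a b. act h (a * b) = (\<Sum>(h1, h2)\<leftarrow>comult H h. act h1 a * act h2 b))"

definition comodule_algebra ::
  "('k::field, 'h::ring_1) hopf \<Rightarrow> ('k \<Rightarrow> 'a::ring_1 \<Rightarrow> 'a) \<Rightarrow> ('a \<Rightarrow> ('h \<times> 'a) list) \<Rightarrow> bool" where
  "comodule_algebra H s \<delta> \<longleftrightarrow>
     tensor_linear s (scal H) s \<delta> \<and>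
     (\<forall>a. tensor3_eq (scal H) (scal H) s
            [(h1, h2, a0). (h, a0) \<leftarrow> \<delta> a, (h1, h2) \<leftarrow> comult H h]
            [(h, h', a'). (h, a0) \<leftarrow> \<delta> a, (h', a') \<leftarrow> \<delta> a0]) \<and>
     (\<forall>a. (\<Sum>(h, a0)\<leftarrow>\<delta> a. s (counit H h) a0) = a) \<and>
     tensor_eq (scal H) s (\<delta> 1) [(1, 1)] \<and>
     (\<forall>a b. tensor_eq (scal H) s (\<delta> (a * b)) (tensor_mult (\<delta> a) (\<delta> b)))"

definition yd_algebra ::
  "('k::field, 'h::ring_1) hopf \<Rightarrow> ('k \<Rightarrow> 'a::ring_1 \<Rightarrow> 'a) \<Rightarrow> ('h \<Rightarrow> 'a \<Rightarrow> 'a) \<Rightarrow>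
   ('a \<Rightarrow> ('h \<times> 'a) list) \<Rightarrow> bool" where
  "yd_algebra H s act \<delta> \<longleftrightarrow>
     k_algebra s \<and> module_algebra H s act \<and> comodule_algebra H s \<delta> \<and>
     (\<forall>h a. tensor_eq (scal H) s (\<delta> (act h a))
        [(h1 * g * antipode H h3, act h2 a0). (h1, h2, h3) \<leftarrow> comult2 H h, (g, a0) \<leftarrow> \<delta> a])"

text \<open>\<open>(e \<otimes> b)(e' \<otimes> b') = e (b\<^sub>(\<^sub>-\<^sub>1\<^sub>) \<cdot> e') \<otimes> b\<^sub>(\<^sub>0\<^sub>) b'\<close>\<close>

definition braided_mult ::
  "('h \<Rightarrow> 'e \<Rightarrow> 'e) \<Rightarrow> ('b \<Rightarrow> ('h \<times> 'b) list) \<Rightarrow>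
   ('e::times \<times> 'b::times) list \<Rightarrow> ('e \<times> 'b) list \<Rightarrow> ('e \<times> 'b) list" where
  "braided_mult act \<delta> u v =
     [(e * act h e', b0 * b'). (e, b) \<leftarrow> u, (e', b') \<leftarrow> v, (h, b0) \<leftarrow> \<delta> b]"

definition braided_algebra_map ::
  "('k::field \<Rightarrow> 'a::ring_1 \<Rightarrow> 'a) \<Rightarrow> ('k \<Rightarrow> 'e::ring_1 \<Rightarrow> 'e) \<Rightarrow> ('k \<Rightarrow> 'b::ring_1 \<Rightarrow> 'b) \<Rightarrow>
   ('h \<Rightarrow> 'e \<Rightarrow> 'e) \<Rightarrow> ('b \<Rightarrow> ('h \<times> 'b) list) \<Rightarrow> ('a \<Rightarrow> ('e \<times> 'b) list) \<Rightarrow> bool" where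
  "braided_algebra_map sA sE sB act \<delta> f \<longleftrightarrow>
     tensor_linear sA sE sB f \<and>
     tensor_eq sE sB (f 1) [(1, 1)] \<and>
     (\<forall>a a'. tensor_eq sE sB (f (a * a')) (braided_mult act \<delta> (f a) (f a')))"

datatype gen = G1 | G2

datatype word = Word "gen list"

instantiation word :: monoid_add
begin

definition zero_word :: word where "zero_word = Word []"

fun plus_word :: "word \<Rightarrow> word \<Rightarrow> word" where
  "plus_word (Word u) (Word v) = Word (u @ v)"

instance
proof
  fix a b c :: word
  show "a + b + c = a + (b + c)" by (cases a; cases b; cases c) simp
  show "0 + a = a" by (cases a) (simp add: zero_word_def)
  show "a + 0 = a" by (cases a) (simp add: zero_word_def)
qed

end

text \<open>\<open>T(V)\<close> is the monoid algebra of the free monoid of words in the basis of \<open>V\<close>.\<close>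

type_synonym 'k tensor_algebra = "word \<Rightarrow>\<^sub>0 'k"

definition tgen :: "gen \<Rightarrow> 'k::field tensor_algebra" where
  "tgen i = Poly_Mapping.single (Word [i]) 1"

definition tscale :: "'k::field \<Rightarrow> 'k tensor_algebra \<Rightarrow> 'k tensor_algebra" where
  "tscale c t = Poly_Mapping.map ((*) c) t"

text \<open>
  The linear map with \<open>a \<mapsto> \<Delta>(a) - a \<otimes> 1 - 1 \<otimes> a\<close> for \<open>a\<close> homogeneous of positive degree and
  \<open>1 \<mapsto> 0\<close>: the degree-zero component is subtracted first.
\<close>

definition reduced_comult ::
  "('k::field tensor_algebra \<Rightarrow> ('k tensor_algebra \<times> 'k tensor_algebra) list) \<Rightarrow>
   'k tensor_algebra \<Rightarrow> ('k tensor_algebra \<times> 'k tensor_algebra) list" where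
  "reduced_comult \<Delta> a =
     (let a' = a - tscale (Poly_Mapping.lookup a 0) 1 in \<Delta> a' @ [(- a', 1), (1, - a')])"

text \<open>
  \<open>A\<close> (with scalar multiplication \<open>s\<close>) is the algebra generated by the images of the two generators
  under \<open>\<pi>\<close> subject to the relations \<open>r = 0\<close> for \<open>r \<in> R\<close>.
\<close>

definition presented_by ::
  "('k::field \<Rightarrow> 'a::ring_1 \<Rightarrow> 'a) \<Rightarrow> ('k tensor_algebra \<Rightarrow> 'a) \<Rightarrow> 'k tensor_algebra set \<Rightarrow> bool" where
  "presented_by s \<pi> R \<longleftrightarrow>
     k_algebra s \<and> algebra_map tscale s \<pi> \<and> surj \<pi> \<and> {t. \<pi> t = 0} = ideal_generated R"

definition q_bracket :: "('k \<Rightarrow> 'a::ring_1 \<Rightarrow> 'a) \<Rightarrow> 'k \<Rightarrow> 'a \<Rightarrow> 'a \<Rightarrow> 'a" where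
  "q_bracket s c u v = u * v - s c (v * u)"

text \<open>The monomial \<open>u\<^sub>2\<^bsup>n2\<^esup> u\<^sub>1\<^sub>2\<^bsup>n12\<^esup> u\<^sub>1\<^bsup>n1\<^esup>\<close>, where \<open>u\<^sub>1\<^sub>2 = u\<^sub>1 u\<^sub>2 - q u\<^sub>2 u\<^sub>1\<close> and \<open>u\<^sub>i = u Gi\<close>.\<close>

definition pbw ::
  "('k::field \<Rightarrow> 'a::ring_1 \<Rightarrow> 'a) \<Rightarrow> 'k \<Rightarrow> (gen \<Rightarrow> 'a) \<Rightarrow> nat \<Rightarrow> nat \<Rightarrow> nat \<Rightarrow> 'a" where
  "pbw s q u n2 n12 n1 = u G2 ^ n2 * q_bracket s q (u G1) (u G2) ^ n12 * u G1 ^ n1"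

definition relators ::
  "'k::field \<Rightarrow> 'k \<Rightarrow> 'k \<Rightarrow> 'k \<Rightarrow> 'k \<Rightarrow> 'k \<Rightarrow> 'k tensor_algebra set" where
  "relators q l1 l2 l12 l112 l122 =
     (let x1 = tgen G1; x2 = tgen G2; x12 = q_bracket tscale q x1 x2;
          x112 = q_bracket tscale (q^2) x1 x12; x122 = q_bracket tscale (q^2) x12 x2
      in {x1 ^ 3 - tscale l1 1, x2 ^ 3 - tscale l2 1, x12 ^ 3 - tscale l12 1,
          x112 - tscale l112 1, x122 - tscale l122 1})"

definition principal_yd_realization ::
  "('k::field, 'h::ring_1) hopf \<Rightarrow> 'k \<Rightarrow> (gen \<Rightarrow> 'h) \<Rightarrow> (gen \<Rightarrow> 'h \<Rightarrow> 'k) \<Rightarrow> bool" where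
  "principal_yd_realization H q g \<chi> \<longleftrightarrow>
     (\<forall>i. group_like H (g i)) \<and>
     (\<forall>i. algebra_map (scal H) (*) (\<chi> i)) \<and>
     (\<forall>i h. scal H (\<chi> i h) (g i) =
        (\<Sum>(h1, h2, h3)\<leftarrow>comult2 H h. scal H (\<chi> i h2) (h1 * g i * antipode H h3))) \<and>
     (\<forall>i j. \<chi> j (g i) = q)"

definition convolution_invertible ::
  "('k::field \<Rightarrow> 'b::ab_group_add \<Rightarrow> 'b) \<Rightarrow> ('k \<Rightarrow> 'e::ring_1 \<Rightarrow> 'e) \<Rightarrow>
   ('b \<Rightarrow> ('b \<times> 'b) list) \<Rightarrow> ('b \<Rightarrow> 'k) \<Rightarrow> ('b \<Rightarrow> 'e) \<Rightarrow> bool" where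
  "convolution_invertible sB sE \<Delta> \<epsilon> f \<longleftrightarrow>
     (\<exists>f'. Vector_Spaces.linear sB sE f' \<and>
        (\<forall>b. (\<Sum>(b1, b2)\<leftarrow>\<Delta> b. f b1 * f' b2) = sE (\<epsilon> b) 1) \<and>
        (\<forall>b. (\<Sum>(b1, b2)\<leftarrow>\<Delta> b. f' b1 * f b2) = sE (\<epsilon> b) 1))"

text \<open>\<open>B\<close> is a right \<open>B\<close>-comodule via \<open>\<Delta>\<close>, and \<open>E\<close> via \<open>\<rho>\<close>.\<close>

definition is_section ::
  "('k::field \<Rightarrow> 'b::ring_1 \<Rightarrow> 'b) \<Rightarrow> ('h \<Rightarrow> 'b \<Rightarrow> 'b) \<Rightarrow> ('b \<Rightarrow> ('b \<times> 'b) list) \<Rightarrow> ('b \<Rightarrow> 'k) \<Rightarrow>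
   ('k \<Rightarrow> 'e::ring_1 \<Rightarrow> 'e) \<Rightarrow> ('h \<Rightarrow> 'e \<Rightarrow> 'e) \<Rightarrow> ('e \<Rightarrow> ('e \<times> 'b) list) \<Rightarrow> ('b \<Rightarrow> 'e) \<Rightarrow> bool" where
  "is_section sB actB \<Delta> \<epsilon> sE actE \<rho> f \<longleftrightarrow>
     Vector_Spaces.linear sB sE f \<and>
     (\<forall>h b. f (actB h b) = actE h (f b)) \<and>
     convolution_invertible sB sE \<Delta> \<epsilon> f \<and>
     bij f \<and>
     (\<forall>b. tensor_eq sE sB (\<rho> (f b)) (tensor_map f id (\<Delta> b))) \<and>
     f 1 = 1"

end

theory Submission
  imports Defs
begin

text \<open>
  Let \<open>\<theta> = (\<epsilon>\<^sub>0 \<otimes> id)\<rho> : E \<rightarrow> B\<close>. By coassociativity \<open>\<theta>\<close> is a comodule map with \<open>\<epsilon>\<theta> = \<epsilon>\<^sub>0\<close>. Since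
  \<open>\<epsilon>\<^sub>0\<pi>\<^sub>E\<tau>\<^sub>2 = \<epsilon>\<^sub>0\<pi>\<^sub>E - \<epsilon>\<pi>\<^sub>B\<close>, the map given by the formula of the theorem is \<open>\<gamma> = 2\<l> - \<l>\<theta>\<l>\<close>. Writing \<open>\<theta>\<l> = 1 + N\<close>,
  one gets \<open>\<theta>\<gamma> = 1 - N\<^sup>2\<close>, so \<open>\<gamma>\<close> is the inverse of \<open>\<theta>\<close> as soon as \<open>N\<^sup>2 = 0\<close>. The values of \<open>\<theta>\<close> on
  the PBW basis follow from \<open>\<rho>(y\<^sub>1\<^sub>2) = y\<^sub>1\<^sub>2 \<otimes> 1 + 1 \<otimes> x\<^sub>1\<^sub>2 + (1 - q\<^sup>2) y\<^sub>1 \<otimes> x\<^sub>2\<close> and from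
  \<open>\<theta>(y\<^sub>2\<^sup>n w) = x\<^sub>2\<^sup>n \<theta>(w)\<close> for \<open>w\<close> in the subalgebra generated by \<open>y\<^sub>1\<^sub>2\<close> and \<open>y\<^sub>1\<close>; they show
  \<open>N\<^sup>2 = 0\<close> and give the explicit formulas. Convolution invertibility holds because \<open>\<gamma>(1) = 1\<close> and \<open>B\<close>
  is connected.
\<close>

subsection \<open>Bilinear maps and tensors\<close>

text \<open>\<open>N\<^sup>2 = 0\<close> because every correction in \<open>\<theta>\<close> of a
  PBW monomial is a multiple of a monomial with \<open>n12 = 0\<close>, or with
  \<open>n12 = 1\<close> and \<open>n1 = 0\<close>, and \<open>N\<close> vanishes on those. The
  corrections have two sources, met when letters collected in the left tensor leg are rewritten in
  the PBW basis: a third \<open>y\<^sub>1\<close> leaves \<open>\<lambda>\<^sub>1\<close>, and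
  \<open>y\<^sub>1\<close> in front of \<open>y\<^sub>1\<^sub>2\<close> leaves
  \<open>\<lambda>\<^sub>1\<^sub>1\<^sub>2\<close>. Coproducts and coaction are given only on
  generators and only up to congruence of lists. Identities between them are therefore tested after
  pairing with bilinear maps; on words the pairing becomes one explicit sum with powers of
  \<open>q\<close>. Equivariance is proved for \<open>\<theta>\<close> and passed to its inverse:
  the conditions on the parameters give each correction the same character as its leading monomial.
  This presupposes that \<open>\<chi>\<^sub>1\<close> and \<open>\<chi>\<^sub>2\<close> commute
  under convolution, which the realization forces.\<close>

lemma linearD:
  assumes "Vector_Spaces.linear s1 s2 f"
  shows "vector_space s1" "vector_space s2"
    "f (a + b) = f a + f b" "f (s1 c a) = s2 c (f a)" "f 0 = 0" "f (- a) = - f a" "f (a - b) = f a - f b"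
proof -
  interpret Vector_Spaces.linear s1 s2 f by fact
  show "vector_space s1" "vector_space s2" by unfold_locales
  show "f (a + b) = f a + f b" "f (s1 c a) = s2 c (f a)" "f 0 = 0" "f (- a) = - f a"
    "f (a - b) = f a - f b"
    by (simp_all add: add scale neg diff)
qed

lemma linearI:
  assumes "vector_space s1" "vector_space s2"
    "\<And>a b. f (a + b) = f a + f b" "\<And>c a. f (s1 c a) = s2 c (f a)"
  shows "Vector_Spaces.linear s1 s2 f"
  using assms by (simp add: Vector_Spaces.linear_iff)

lemma scale_laws:
  assumes "vector_space s"
  shows "s c (a + b) = s c a + s c b" "s (c + d) a = s c a + s d a" "s c (s d a) = s (c * d) a"
    "s 1 a = a" "s 0 a = 0" "s c 0 = 0" "s c (- a) = - s c a" "s (- c) a = - s c a"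
    "s c (a - b) = s c a - s c b" "s (c - d) a = s c a - s d a"
proof -
  interpret vector_space s by fact
  show "s c (a + b) = s c a + s c b" "s (c + d) a = s c a + s d a" "s c (s d a) = s (c * d) a"
    "s 1 a = a" "s 0 a = 0" "s c 0 = 0" "s c (- a) = - s c a" "s (- c) a = - s c a"
    "s c (a - b) = s c a - s c b" "s (c - d) a = s c a - s d a"
    by (simp_all add: scale_right_distrib scale_left_distrib scale_right_diff_distrib
        scale_left_diff_distrib)
qed

lemma vector_space_field: "vector_space ((*) :: 'k::field \<Rightarrow> _)"
  by unfold_locales (simp_all add: algebra_simps)

lemma linear_sum_list:
  assumes "vector_space s1" "vector_space s2"
    and "\<And>p. p \<in> set u \<Longrightarrow> Vector_Spaces.linear s1 s2 (f p)"
  shows "Vector_Spaces.linear s1 s2 (\<lambda>a. \<Sum>p\<leftarrow>u. f p a)"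
  using assms(3)
  by (induction u) (auto simp: Vector_Spaces.linear_iff scale_laws assms(1,2))

lemma linear_comp:
  assumes "Vector_Spaces.linear s1 s2 f" "Vector_Spaces.linear s2 s3 h"
  shows "Vector_Spaces.linear s1 s3 (\<lambda>a. h (f a))"
  by (rule linearI) (simp_all add: linearD[OF assms(1)] linearD[OF assms(2)])

lemma linear_eq_on_spanning:
  assumes "Vector_Spaces.linear s1 s2 f" "Vector_Spaces.linear s1 s2 g"
    and "module.span s1 S = UNIV" and "\<And>a. a \<in> S \<Longrightarrow> f a = g a"
  shows "f = g"
proof
  fix a
  interpret Vector_Spaces.linear s1 s2 f by fact
  have "a \<in> vs1.span S" using assms(3) by simp
  then show "f a = g a"
    by (induction rule: vs1.span_induct_alt)
      (simp_all add: linearD[OF assms(1)] linearD[OF assms(2)] assms(4))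
qed

definition bilinear_map ::
  "('k::field \<Rightarrow> 'a::ab_group_add \<Rightarrow> 'a) \<Rightarrow> ('k \<Rightarrow> 'b::ab_group_add \<Rightarrow> 'b) \<Rightarrow>
   ('k \<Rightarrow> 'c::ab_group_add \<Rightarrow> 'c) \<Rightarrow> ('a \<Rightarrow> 'b \<Rightarrow> 'c) \<Rightarrow> bool" where
  "bilinear_map sA sB sC \<beta> \<longleftrightarrow>
     (\<forall>b. Vector_Spaces.linear sA sC (\<lambda>a. \<beta> a b)) \<and> (\<forall>a. Vector_Spaces.linear sB sC (\<beta> a))"

lemma bilinear_mapI:
  assumes "\<And>b. Vector_Spaces.linear sA sC (\<lambda>a. \<beta> a b)" "\<And>a. Vector_Spaces.linear sB sC (\<beta> a)"
  shows "bilinear_map sA sB sC \<beta>"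
  using assms by (simp add: bilinear_map_def)

lemma bilinear_mapD:
  assumes "bilinear_map sA sB sC \<beta>"
  shows "vector_space sA" "vector_space sB" "vector_space sC"
    "\<beta> (a + a') b = \<beta> a b + \<beta> a' b" "\<beta> a (b + b') = \<beta> a b + \<beta> a b'"
    "\<beta> (sA c a) b = sC c (\<beta> a b)" "\<beta> a (sB c b) = sC c (\<beta> a b)"
    "\<beta> 0 b = 0" "\<beta> a 0 = 0" "\<beta> (- a) b = - \<beta> a b" "\<beta> a (- b) = - \<beta> a b"
proof -
  have 1: "Vector_Spaces.linear sA sC (\<lambda>a. \<beta> a b)" and 2: "Vector_Spaces.linear sB sC (\<beta> a)" for a b
    using assms by (simp_all add: bilinear_map_def)
  show "vector_space sA" "vector_space sB" "vector_space sC"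
    "\<beta> (a + a') b = \<beta> a b + \<beta> a' b" "\<beta> a (b + b') = \<beta> a b + \<beta> a b'"
    "\<beta> (sA c a) b = sC c (\<beta> a b)" "\<beta> a (sB c b) = sC c (\<beta> a b)"
    "\<beta> 0 b = 0" "\<beta> a 0 = 0" "\<beta> (- a) b = - \<beta> a b" "\<beta> a (- b) = - \<beta> a b"
    by (simp_all add: linearD[OF 1] linearD[OF 2])
qed

lemma bilinear_map_compose:
  assumes "Vector_Spaces.linear sA' sA f" "Vector_Spaces.linear sB' sB g" "bilinear_map sA sB sC \<beta>"
  shows "bilinear_map sA' sB' sC (\<lambda>a b. \<beta> (f a) (g b))"
  by (rule bilinear_mapI; rule linearI)
    (simp_all add: linearD[OF assms(1)] linearD[OF assms(2)] bilinear_mapD[OF assms(3)])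

lemma bilinear_map_add:
  assumes "bilinear_map sA sB sC \<beta>" "bilinear_map sA sB sC \<beta>'"
  shows "bilinear_map sA sB sC (\<lambda>a b. \<beta> a b + \<beta>' a b)"
  by (rule bilinear_mapI; rule linearI)
    (simp_all add: bilinear_mapD[OF assms(1)] bilinear_mapD[OF assms(2)]
      scale_laws[OF bilinear_mapD(3)[OF assms(1)]] algebra_simps)

lemma bilinear_map_scale:
  assumes "vector_space s"
  shows "bilinear_map (*) s s s" "bilinear_map s (*) s (\<lambda>a c. s c a)"
  by (auto intro!: bilinear_mapI linearI simp: scale_laws[OF assms] assms vector_space_field mult.commute)

lemma tensor_lift_simps [simp]:
  "tensor_lift \<beta> [] = 0"
  "tensor_lift \<beta> (p # u) = \<beta> (fst p) (snd p) + tensor_lift \<beta> u"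
  "tensor_lift \<beta> (u @ v) = tensor_lift \<beta> u + tensor_lift \<beta> v"
  by (simp_all add: tensor_lift_def case_prod_unfold)

lemma tensor_lift_map: "tensor_lift \<beta> (map f u) = (\<Sum>p\<leftarrow>u. \<beta> (fst (f p)) (snd (f p)))"
  by (simp add: tensor_lift_def case_prod_unfold comp_def)

lemma tensor_lift_tensor_map:
  "tensor_lift \<beta> (tensor_map f g u) = tensor_lift (\<lambda>a b. \<beta> (f a) (g b)) u"
  by (simp add: tensor_lift_def tensor_map_def case_prod_unfold comp_def)

lemma tensor_lift_linear_image:
  assumes "Vector_Spaces.linear s1 s2 f"
  shows "f (tensor_lift \<beta> u) = tensor_lift (\<lambda>a b. f (\<beta> a b)) u"
  by (induction u) (simp_all add: linearD[OF assms])

lemma tensor_lift_add: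
  "tensor_lift (\<lambda>a b. \<beta> a b + \<beta>' a b) u = tensor_lift \<beta> u + tensor_lift \<beta>' u"
  by (induction u) (simp_all add: algebra_simps)

text \<open>Descent to the tensor product: a bilinear map respects each rule generating the
  congruence, so the value does not depend on the representing list.\<close>

lemma tensor_lift_cong:
  assumes "tensor_eq sA sB u v" "bilinear_map sA sB sC \<beta>"
  shows "tensor_lift \<beta> u = tensor_lift \<beta> v"
  using assms(1) by induction (simp_all add: bilinear_mapD[OF assms(2)] algebra_simps)

lemma tensor_lift_linear:
  assumes "tensor_linear sA sB sC f" "bilinear_map sB sC sD \<beta>" "vector_space sA"
  shows "Vector_Spaces.linear sA sD (\<lambda>a. tensor_lift \<beta> (f a))"
proof (rule linearI)
  show "tensor_lift \<beta> (f (a + a')) = tensor_lift \<beta> (f a) + tensor_lift \<beta> (f a')" for a a'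
    using tensor_lift_cong[of sB sC "f (a + a')" "f a @ f a'", OF _ assms(2)] assms(1)
    by (simp add: tensor_linear_def)
  show "tensor_lift \<beta> (f (sA c a)) = sD c (tensor_lift \<beta> (f a))" for c a
  proof -
    have "tensor_lift \<beta> (f (sA c a)) = tensor_lift \<beta> (map (\<lambda>(b, b'). (sB c b, b')) (f a))"
      using tensor_lift_cong[OF _ assms(2)] assms(1) by (simp add: tensor_linear_def)
    also have "\<dots> = tensor_lift (\<lambda>b b'. sD c (\<beta> b b')) (f a)"
      by (simp add: tensor_lift_def case_prod_unfold comp_def bilinear_mapD[OF assms(2)])
    also have "\<dots> = sD c (tensor_lift \<beta> (f a))"
      by (rule tensor_lift_linear_image[symmetric, where ?s1.0 = sD and ?s2.0 = sD])
        (auto intro!: linearI simp: scale_laws bilinear_mapD[OF assms(2)] mult.commute)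
    finally show ?thesis .
  qed
qed (use assms bilinear_mapD in auto)

section \<open>Equality of tensors tested by functionals on one factor\<close>

lemma tensor_eq_zero_list: "tensor_eq sA sB (map (\<lambda>v. (0, v)) vs) []"
proof (induction vs)
  case (Cons v vs)
  show ?case using tensor_eq.append[OF tensor_eq.zero Cons] by simp
qed (simp add: tensor_eq.refl)

lemma tensor_eq_add_list:
  "tensor_eq sA sB (map (\<lambda>v. (f v + g v, v)) vs) (map (\<lambda>v. (f v, v)) vs @ map (\<lambda>v. (g v, v)) vs)"
proof (induction vs)
  case (Cons v vs)
  have "tensor_eq sA sB ([(f v + g v, v)] @ map (\<lambda>v. (f v + g v, v)) vs)
      ([(f v, v), (g v, v)] @ map (\<lambda>v. (f v, v)) vs @ map (\<lambda>v. (g v, v)) vs)"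
    by (rule tensor_eq.append[OF tensor_eq.add_left Cons])
  moreover have "tensor_eq sA sB ([(f v, v)] @ ([(g v, v)] @ map (\<lambda>v. (f v, v)) vs) @ map (\<lambda>v. (g v, v)) vs)
     ([(f v, v)] @ (map (\<lambda>v. (f v, v)) vs @ [(g v, v)]) @ map (\<lambda>v. (g v, v)) vs)"
    by (intro tensor_eq.append tensor_eq.refl tensor_eq.comm)
  ultimately show ?case
    by (auto intro: tensor_eq.trans)
qed (simp add: tensor_eq.refl)

lemma tensor_eq_combination:
  assumes "vector_space sA" "vector_space sB"
  shows "tensor_eq sA sB [(a, \<Sum>v\<leftarrow>vs. sB (\<xi> v) v)] (map (\<lambda>v. (sA (\<xi> v) a, v)) vs)"
proof (induction vs)
  case Nil
  have "tensor_eq sA sB [(a, sB 0 0)] [(sA 0 a, 0)]"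
    by (rule tensor_eq.sym, rule tensor_eq.balanced)
  then show ?case
    by (auto simp: scale_laws assms intro: tensor_eq.trans tensor_eq.zero)
next
  case (Cons v vs)
  have "tensor_eq sA sB [(a, sB (\<xi> v) v + (\<Sum>v\<leftarrow>vs. sB (\<xi> v) v))]
      ([(a, sB (\<xi> v) v)] @ [(a, \<Sum>v\<leftarrow>vs. sB (\<xi> v) v)])"
    using tensor_eq.add_right by simp
  moreover have "tensor_eq sA sB ([(a, sB (\<xi> v) v)] @ [(a, \<Sum>v\<leftarrow>vs. sB (\<xi> v) v)])
      ([(sA (\<xi> v) a, v)] @ map (\<lambda>v. (sA (\<xi> v) a, v)) vs)"
    by (intro tensor_eq.append Cons tensor_eq.sym[OF tensor_eq.balanced])
  ultimately show ?case by (auto intro: tensor_eq.trans)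
qed

lemma tensor_eqI:
  assumes A: "vector_space sA" and B: "vector_space sB"
    and S: "finite S" "module.span sB S = UNIV"
    and eq: "\<And>\<xi>. Vector_Spaces.linear sB (*) \<xi> \<Longrightarrow>
      tensor_lift (\<lambda>a b. sA (\<xi> b) a) u = tensor_lift (\<lambda>a b. sA (\<xi> b) a) v"
  shows "tensor_eq sA sB u v"
proof -
  interpret B: vector_space sB by fact
  obtain Q where Q: "Q \<subseteq> S" "B.independent Q" "S \<subseteq> B.span Q"
    using B.maximal_independent_subset by blast
  have "finite Q" using Q(1) S(1) finite_subset by blast
  have spanQ: "B.span Q = UNIV"
    using B.span_mono[OF Q(3)] S(2) by (simp add: B.span_span top.extremum_uniqueI)
  obtain vs where vs: "set vs = Q" "distinct vs"
    using \<open>finite Q\<close> finite_distinct_list by blast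
  define \<xi> where "\<xi> w b = B.representation Q b w" for w b
  have lin: "Vector_Spaces.linear sB (*) (\<xi> w)" for w
    unfolding \<xi>_def using Q(2) spanQ
    by (intro linearI B vector_space_field) (simp_all add: B.representation_add B.representation_scale)
  have repr: "b = (\<Sum>w\<leftarrow>vs. sB (\<xi> w b) w)" for b
    using B.sum_representation_eq[of Q b Q] Q(2) spanQ \<open>finite Q\<close> vs
    by (simp add: \<xi>_def sum_list_distinct_conv_sum_set)
  \<comment> \<open>Normal form of a tensor: one pair for each vector of a basis of the second
    factor, with its coefficient in the first. The coefficients are exactly the pairings compared in
    \<open>eq\<close>.\<close>
  define L where "L u = map (\<lambda>w. (tensor_lift (\<lambda>a b. sA (\<xi> w b) a) u, w)) vs" for u
  have normal: "tensor_eq sA sB u (L u)" for u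
  proof (induction u)
    case Nil
    then show ?case by (simp add: L_def tensor_eq.sym[OF tensor_eq_zero_list])
  next
    case (Cons p u)
    obtain a b where p: "p = (a, b)" by fastforce
    have "tensor_eq sA sB [p] (map (\<lambda>w. (sA (\<xi> w b) a, w)) vs)"
      using tensor_eq_combination[OF A B, of a "\<lambda>w. \<xi> w b" vs] repr[of b] p by simp
    from tensor_eq.append[OF this Cons]
    have "tensor_eq sA sB (p # u) (map (\<lambda>w. (sA (\<xi> w b) a, w)) vs @ L u)" by simp
    moreover have "tensor_eq sA sB (L (p # u)) (map (\<lambda>w. (sA (\<xi> w b) a, w)) vs @ L u)"
      using tensor_eq_add_list[of sA sB "\<lambda>w. sA (\<xi> w b) a"] p by (simp add: L_def)
    ultimately show ?case by (meson tensor_eq.sym tensor_eq.trans)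
  qed
  have "L u = L v" by (simp add: L_def eq lin)
  then show ?thesis using normal[of u] normal[of v] by (metis tensor_eq.sym tensor_eq.trans)
qed

lemma k_algebraD:
  assumes "k_algebra s"
  shows "vector_space s" "s c a * b = s c (a * b)" "a * s c b = s c (a * b)"
  using assms unfolding k_algebra_def by metis+

lemma linear_mult:
  assumes "k_algebra s"
  shows "Vector_Spaces.linear s s (\<lambda>a. p * a)" "Vector_Spaces.linear s s (\<lambda>a. a * p)"
  by (auto intro!: linearI simp: k_algebraD[OF assms] algebra_simps)

lemma algebra_map_prod_list:
  assumes "algebra_map sA sB f"
  shows "f (prod_list (map a w)) = prod_list (map (\<lambda>i. f (a i)) w)"
  using assms by (induction w) (simp_all add: algebra_map_def)

text \<open>In the braided product, \<open>(y \<otimes> 1 + 1 \<otimes> x)(e \<otimes> b) = y e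
  \<otimes> b + (g \<cdot> e) \<otimes> x b\<close>: moving \<open>x\<close> past \<open>e\<close>
  makes the coaction component \<open>g\<close> of \<open>x\<close> act on \<open>e\<close>.\<close>

lemma tensor_lift_braided_mult_generator:
  assumes f: "braided_algebra_map sA sE sB act \<delta> f"
    and E: "k_algebra sE" "module_algebra H sE act"
    and B: "k_algebra sB" "tensor_linear sB (scal H) sB \<delta>"
      "tensor_eq (scal H) sB (\<delta> 1) [(1, 1)]" "tensor_eq (scal H) sB (\<delta> x) [(g, x)]"
    and a: "tensor_eq sE sB (f a) [(y, 1), (1, x)]"
    and \<beta>: "bilinear_map sE sB sC \<beta>"
  shows "tensor_lift \<beta> (f (a * a')) = tensor_lift (\<lambda>e b. \<beta> (y * e) b + \<beta> (act g e) (x * b)) (f a')"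
proof -
  have VE: "vector_space sE" and VB: "vector_space sB" using E B by (auto simp: k_algebraD)
  have act1: "Vector_Spaces.linear (scal H) sE (\<lambda>h. act h e)" and "act 1 e = e" for e
    using E(2) by (simp_all add: module_algebra_def)
  define \<eta> where "\<eta> e e' b' = (\<lambda>h b0. \<beta> (e * act h e') (b0 * b'))" for e e' b'
  \<comment> \<open>The product with \<open>f a'\<close> as a function of its left factor. It is
    bilinear, so the unknown list \<open>f a\<close> may be replaced by
    \<open>[(y, 1), (1, x)]\<close>.\<close>
  define \<Gamma> where "\<Gamma> e b = (\<Sum>(e', b')\<leftarrow>f a'. tensor_lift (\<eta> e e' b') (\<delta> b))" for e b
  have \<eta>: "bilinear_map (scal H) sB sC (\<eta> e e' b')" for e e' b'
    unfolding \<eta>_def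
  proof (rule bilinear_map_compose[where f = "\<lambda>h. e * act h e'" and g = "\<lambda>b. b * b'", OF _ _ \<beta>])
    show "Vector_Spaces.linear (scal H) sE (\<lambda>h. e * act h e')"
      by (rule linearI) (simp_all add: linearD[OF act1] k_algebraD[OF E(1)] algebra_simps)
    show "Vector_Spaces.linear sB sB (\<lambda>b. b * b')" by (rule linear_mult[OF B(1)])
  qed
  have "Vector_Spaces.linear sE sC (\<lambda>e. tensor_lift (\<eta> e e' b') (\<delta> b))" for e' b' b
    unfolding tensor_lift_def \<eta>_def
    by (rule linear_sum_list)
      (auto intro!: linearI simp: case_prod_unfold bilinear_mapD[OF \<beta>] k_algebraD[OF E(1)] algebra_simps)
  then have "bilinear_map sE sB sC \<Gamma>"
    unfolding \<Gamma>_def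
    by (intro bilinear_mapI linear_sum_list bilinear_mapD[OF \<beta>])
      (auto simp: tensor_lift_linear[OF B(2) \<eta> VB])
  note \<Gamma> = tensor_lift_cong[OF a this]
  have lift: "tensor_lift \<beta> (braided_mult act \<delta> u (f a')) = tensor_lift \<Gamma> u" for u
  proof (induction u)
    case (Cons p u)
    have "tensor_lift \<beta> (concat (map (\<lambda>(e', b'). map (\<lambda>(h, b0). (e * act h e', b0 * b')) (\<delta> b)) v))
      = (\<Sum>(e', b')\<leftarrow>v. tensor_lift (\<eta> e e' b') (\<delta> b))" for e b v
      by (induction v) (auto simp: tensor_lift_map \<eta>_def tensor_lift_def case_prod_unfold comp_def)
    with Cons show ?case
      by (cases p) (simp add: braided_mult_def \<Gamma>_def)
  qed (simp add: braided_mult_def)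
  have "tensor_lift \<beta> (f (a * a')) = tensor_lift \<beta> (braided_mult act \<delta> (f a) (f a'))"
    using f tensor_lift_cong[OF _ \<beta>] by (simp add: braided_algebra_map_def)
  also have "\<dots> = \<Gamma> y 1 + \<Gamma> 1 x" by (simp add: lift \<Gamma>)
  also have "\<dots> = tensor_lift (\<lambda>e b. \<beta> (y * e) b + \<beta> (act g e) (x * b)) (f a')"
    unfolding \<Gamma>_def tensor_lift_cong[OF B(3) \<eta>] tensor_lift_cong[OF B(4) \<eta>]
    by (simp add: \<eta>_def \<open>\<And>e. act 1 e = e\<close> tensor_lift_add)
      (simp add: tensor_lift_def)
  finally show ?thesis .
qed

subsection \<open>The braided coproduct of words\<close>

text \<open>
  The braided coproduct of a word, paired with a map \<open>F\<close> on pairs of words: it sends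
  \<open>i w\<close> to \<open>\<Sum> i w\<^sub>(\<^sub>1\<^sub>) \<otimes> w\<^sub>(\<^sub>2\<^sub>) + q\<^bsup>|w\<^sub>(\<^sub>1\<^sub>)|\<^esup> w\<^sub>(\<^sub>1\<^sub>) \<otimes> i w\<^sub>(\<^sub>2\<^sub>)\<close>.
\<close>

fun word_comult_sum ::
  "('k::field \<Rightarrow> 'c::ab_group_add \<Rightarrow> 'c) \<Rightarrow> 'k \<Rightarrow> ('i list \<Rightarrow> 'i list \<Rightarrow> 'c) \<Rightarrow> 'i list \<Rightarrow> 'c" where
  "word_comult_sum s q F [] = F [] []"
| "word_comult_sum s q F (i # w) =
     word_comult_sum s q (\<lambda>u v. F (i # u) v + s (q ^ length u) (F u (i # v))) w"

lemma word_comult_sum_linear_image: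
  assumes "Vector_Spaces.linear s1 s2 f"
  shows "f (word_comult_sum s1 q F w) = word_comult_sum s2 q (\<lambda>u v. f (F u v)) w"
  by (induction w arbitrary: F) (simp_all add: linearD[OF assms])

lemma word_comult_sum_add:
  assumes "vector_space s"
  shows "word_comult_sum s q (\<lambda>u v. F u v + G u v) w = word_comult_sum s q F w + word_comult_sum s q G w"
proof (induction w arbitrary: F G)
  case (Cons i w)
  have "word_comult_sum s q (\<lambda>u v. F u v + G u v) (i # w) =
    word_comult_sum s q (\<lambda>u v. (F (i # u) v + s (q ^ length u) (F u (i # v)))
      + (G (i # u) v + s (q ^ length u) (G u (i # v)))) w"
    by (simp add: scale_laws[OF assms] add_ac)
  then show ?case by (simp add: Cons)
qed simp

lemma word_comult_sum_cong:
  assumes "\<And>u v. length u + length v = length w \<Longrightarrow> F u v = G u v"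
  shows "word_comult_sum s q F w = word_comult_sum s q G w"
  using assms
proof (induction w arbitrary: F G)
  case (Cons i w)
  have "word_comult_sum s q (\<lambda>u v. F (i # u) v + s (q ^ length u) (F u (i # v))) w =
    word_comult_sum s q (\<lambda>u v. G (i # u) v + s (q ^ length u) (G u (i # v))) w"
    by (intro Cons.IH) (simp add: Cons.prems)
  then show ?case by simp
qed simp

text \<open>Both sides distribute the letters over three factors, each letter weighted by
  \<open>q\<close> to the number of letters it crosses. The arbitrary \<open>F\<close> lets one
  identity serve both the comodule property of \<open>\<theta>\<close> and the associativity of
  convolution.\<close>

lemma word_comult_sum_coassoc:
  assumes "vector_space s"
  shows "word_comult_sum s q (\<lambda>u v. word_comult_sum s q (\<lambda>u1 u2. F u1 u2 v) u) w =
    word_comult_sum s q (\<lambda>u v. word_comult_sum s q (F u) v) w"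
proof (induction w arbitrary: F)
  case (Cons i w)
  have lin: "Vector_Spaces.linear s s (s c)" for c
    by (auto intro!: linearI simp: assms scale_laws mult.commute)
  note [simp] = word_comult_sum_add[OF assms] word_comult_sum_linear_image[OF lin]
    scale_laws[OF assms] power_add mult.assoc
  have len: "word_comult_sum s q (\<lambda>u1 u2. s (q ^ length u) (F u1 u2 v)) u =
    word_comult_sum s q (\<lambda>u1 u2. s (q ^ (length u1 + length u2)) (F u1 u2 v)) u" for F u v
    by (rule word_comult_sum_cong) (simp flip: power_add)
  \<comment> \<open>The new first letter goes to the first, second or third factor and crosses 0,
    \<open>length u1\<close> or \<open>length u1 + length u2\<close> letters.\<close>
  define F' where "F' u1 u2 u3 = F (i # u1) u2 u3 + s (q ^ length u1) (F u1 (i # u2) u3)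
    + s (q ^ (length u1 + length u2)) (F u1 u2 (i # u3))" for u1 u2 u3
  have "word_comult_sum s q (\<lambda>u v. word_comult_sum s q (\<lambda>u1 u2. F u1 u2 v) u) (i # w) =
    word_comult_sum s q (\<lambda>u v. word_comult_sum s q (\<lambda>u1 u2. F' u1 u2 v) u) w"
    using len[of _ "\<lambda>u1 u2 v. F u1 u2 (i # v)"] by (simp add: F'_def)
  moreover have "word_comult_sum s q (\<lambda>u v. word_comult_sum s q (F u) v) (i # w) =
    word_comult_sum s q (\<lambda>u v. word_comult_sum s q (F' u) v) w"
    by (simp add: F'_def[abs_def] add_ac)
  ultimately show ?case by (simp only: Cons)
qed simp

lemma word_comult_sum_counit:
  fixes F :: "'i list \<Rightarrow> 'c::ab_group_add"
  assumes "vector_space s"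
  shows "word_comult_sum s q (\<lambda>u v. if u = [] then F v else 0) w = F w"
    and "word_comult_sum s q (\<lambda>u v. if v = [] then F u else 0) w = F w"
proof -
  have "(\<lambda>u v. (if i # u = [] then F v else 0) +
      s (q ^ length u) (if u = [] then F (i # v) else 0)) = (\<lambda>u v. if u = [] then F (i # v) else 0)"
    for i and F :: "'i list \<Rightarrow> 'c"
    by (auto simp: fun_eq_iff scale_laws[OF assms])
  then show "word_comult_sum s q (\<lambda>u v. if u = [] then F v else 0) w = F w"
    by (induction w arbitrary: F) auto
  have "(\<lambda>u v. (if v = [] then F (i # u) else 0) +
      s (q ^ length u) (if i # v = [] then F u else 0)) = (\<lambda>u v. if v = [] then F (i # u) else 0)"
    for i and F :: "'i list \<Rightarrow> 'c"
    by (auto simp: fun_eq_iff scale_laws[OF assms])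
  then show "word_comult_sum s q (\<lambda>u v. if v = [] then F u else 0) w = F w"
    by (induction w arbitrary: F) auto
qed

text \<open>Shared by the coproducts of \<open>T(V)\<close> and of the Nichols algebra and by the
  coaction on \<open>E\<close>: each is a braided algebra map sending generators to
  \<open>y i \<otimes> 1 + 1 \<otimes> x i\<close>. Since \<open>g i\<close> scales a word by
  \<open>q\<close> to its length, the braiding becomes the scalar in
  \<open>word_comult_sum\<close>.\<close>

lemma tensor_lift_word:
  assumes f: "braided_algebra_map sA sE sB act \<delta> f"
    and E: "k_algebra sE" "module_algebra H sE act" "\<And>i u. act (g i) (prod_list (map y u)) =
      sE (q ^ length u) (prod_list (map y u))"
    and B: "k_algebra sB" "tensor_linear sB (scal H) sB \<delta>"
      "tensor_eq (scal H) sB (\<delta> 1) [(1, 1)]" "\<And>i. tensor_eq (scal H) sB (\<delta> (x i)) [(g i, x i)]"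
    and a: "\<And>i. tensor_eq sE sB (f (a i)) [(y i, 1), (1, x i)]"
    and \<beta>: "bilinear_map sE sB sC \<beta>"
  shows "tensor_lift \<beta> (f (prod_list (map a w))) =
    word_comult_sum sC q (\<lambda>u v. \<beta> (prod_list (map y u)) (prod_list (map x v))) w"
  using \<beta>
proof (induction w arbitrary: \<beta>)
  case Nil
  have "tensor_eq sE sB (f 1) [(1, 1)]" using f by (simp add: braided_algebra_map_def)
  from tensor_lift_cong[OF this Nil] show ?case by simp
next
  case (Cons i w)
  have act: "Vector_Spaces.linear sE sE (act h)" for h
    using E(2) by (simp add: module_algebra_def)
  have "bilinear_map sE sB sC (\<lambda>e b. \<beta> (y i * e) b + \<beta> (act (g i) e) (x i * b))"
    using bilinear_map_add[OF bilinear_map_compose[OF linear_mult(1)[OF E(1)] _ Cons.prems]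
        bilinear_map_compose[OF act linear_mult(1)[OF B(1)] Cons.prems]]
      bilinear_map_compose[OF linear_mult(1)[OF E(1)] _ Cons.prems] k_algebraD(1)[OF B(1)]
    by (simp add: linearI)
  from Cons.IH[OF this] show ?case
    using tensor_lift_braided_mult_generator[OF f E(1,2) B(1-3) B(4) a Cons.prems, of i]
    by (simp add: E(3) bilinear_mapD[OF Cons.prems])
qed

lemma span_words:
  assumes "vector_space (tscale :: 'k::field \<Rightarrow> _)"
  shows "module.span tscale (range (\<lambda>w. prod_list (map tgen w))) = (UNIV :: 'k tensor_algebra set)"
proof -
  interpret vector_space "tscale :: 'k \<Rightarrow> _" by fact
  have word: "prod_list (map tgen w) = (Poly_Mapping.single (Word w) 1 :: 'k tensor_algebra)" for w
    by (induction w) (simp_all add: tgen_def mult_single flip: zero_word_def)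
  have "t \<in> span (range (\<lambda>w. prod_list (map tgen w)))" for t :: "'k tensor_algebra"
  proof (induction t rule: Poly_Mapping.update_induct)
    case (update t m c)
    obtain w where m: "m = Word w" by (cases m)
    have "Poly_Mapping.update m c t = t + tscale c (prod_list (map tgen w))"
      using update(1)
      by (intro poly_mapping_eqI)
        (auto simp: word m lookup_update lookup_add tscale_def lookup_single when_def in_keys_iff)
    then show ?case using update(3) by (simp add: span_add span_scale span_base)
  qed (simp add: span_zero)
  then show ?thesis by auto
qed

lemma linear_eq_on_words:
  assumes "Vector_Spaces.linear tscale s f" "Vector_Spaces.linear tscale s f'"
    and "\<And>w. f (prod_list (map tgen w)) = f' (prod_list (map tgen w))"
  shows "f t = f' t"
  using linear_eq_on_spanning[OF assms(1,2) span_words[OF linearD(1)[OF assms(1)]]] assms(3)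
  by (auto simp: fun_eq_iff)

subsection \<open>Convolution of functionals on a Hopf algebra\<close>

lemma tensor3_eq_sum_cong:
  assumes "tensor3_eq sA sB sC u v"
    and "Vector_Spaces.linear sA (*) \<phi>" "Vector_Spaces.linear sB (*) \<psi>" "Vector_Spaces.linear sC (*) \<omega>"
  shows "(\<Sum>(a, b, c)\<leftarrow>u. \<phi> a * \<psi> b * \<omega> c) = (\<Sum>(a, b, c)\<leftarrow>v. \<phi> a * \<psi> b * \<omega> c)"
  using assms(1)
  by induction (simp_all add: linearD[OF assms(2)] linearD[OF assms(3)] linearD[OF assms(4)] algebra_simps)

lemma bilinear_map_functionals:
  assumes "Vector_Spaces.linear sA (*) \<phi>" "Vector_Spaces.linear sB (*) \<psi>"
  shows "bilinear_map sA sB (*) (\<lambda>a b. \<phi> a * \<psi> b)"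
  using bilinear_map_compose[OF assms bilinear_map_scale(1)[OF vector_space_field]] .

lemma conv_eq_tensor_lift: "conv H \<phi> \<psi> h = tensor_lift (\<lambda>a b. \<phi> a * \<psi> b) (comult H h)"
  by (simp add: conv_def tensor_lift_def)

context
  fixes H :: "('k::field, 'h::ring_1) hopf"
  assumes H: "hopf_algebra H"
begin

abbreviation (input) "functional \<phi> \<equiv> Vector_Spaces.linear (scal H) (*) \<phi>"

lemma linear_conv: "functional \<phi> \<Longrightarrow> functional \<psi> \<Longrightarrow> functional (conv H \<phi> \<psi>)"
  using tensor_lift_linear[OF _ bilinear_map_functionals, of "scal H" "scal H" "scal H" "comult H" \<phi> \<psi>] H
  by (auto simp: hopf_algebra_def k_algebra_def conv_eq_tensor_lift[abs_def])

lemma linear_counit: "functional (counit H)"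
  using H by (simp add: hopf_algebra_def algebra_map_def)

lemma conv_counit:
  assumes "functional \<phi>"
  shows "conv H (counit H) \<phi> = \<phi>" "conv H \<phi> (counit H) = \<phi>"
proof -
  have sum: "\<phi> (\<Sum>(a, b)\<leftarrow>u. f a b) = (\<Sum>(a, b)\<leftarrow>u. \<phi> (f a b))" for f and u :: "('h \<times> 'h) list"
    using tensor_lift_linear_image[OF assms] by (simp add: tensor_lift_def)
  show "conv H (counit H) \<phi> = \<phi>"
  proof
    fix h
    have "\<phi> h = \<phi> (\<Sum>(h1, h2)\<leftarrow>comult H h. scal H (counit H h1) h2)"
      using H by (simp add: hopf_algebra_def)
    then show "conv H (counit H) \<phi> h = \<phi> h"
      by (simp add: conv_def sum linearD[OF assms])
  qed
  show "conv H \<phi> (counit H) = \<phi>"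
  proof
    fix h
    have "\<phi> h = \<phi> (\<Sum>(h1, h2)\<leftarrow>comult H h. scal H (counit H h2) h1)"
      using H by (simp add: hopf_algebra_def)
    then show "conv H \<phi> (counit H) h = \<phi> h"
      by (simp add: conv_def sum linearD[OF assms] mult.commute)
  qed
qed

lemma sum_comult2:
  "(\<Sum>(a, b, c)\<leftarrow>comult2 H h. \<phi> a * \<psi> b * \<omega> c) = conv H \<phi> (conv H \<psi> \<omega>) h"
proof -
  have "(\<Sum>(a, b, c)\<leftarrow>concat (map (\<lambda>(h1, t). map (\<lambda>(h2, h3). (h1, h2, h3)) (comult H t)) u).
      \<phi> a * \<psi> b * \<omega> c) = (\<Sum>(h1, t)\<leftarrow>u. \<phi> h1 * conv H \<psi> \<omega> t)" for u
    by (induction u)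
      (auto simp: conv_def comp_def case_prod_unfold sum_list_const_mult[symmetric] mult.assoc)
  then show ?thesis by (simp add: comult2_def conv_def)
qed

lemma conv_assoc:
  assumes "functional \<phi>" "functional \<psi>" "functional \<omega>"
  shows "conv H (conv H \<phi> \<psi>) \<omega> = conv H \<phi> (conv H \<psi> \<omega>)"
proof
  fix h
  have "(\<Sum>(a, b, c)\<leftarrow>concat (map (\<lambda>(t, h3). map (\<lambda>(h1, h2). (h1, h2, h3)) (comult H t)) u).
      \<phi> a * \<psi> b * \<omega> c) = (\<Sum>(t, h3)\<leftarrow>u. conv H \<phi> \<psi> t * \<omega> h3)" for u
    by (induction u)
      (auto simp: conv_def comp_def case_prod_unfold sum_list_mult_const[symmetric] mult.assoc)
  then have "conv H (conv H \<phi> \<psi>) \<omega> h =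
    (\<Sum>(a, b, c)\<leftarrow>[(h1, h2, h3). (t, h3) \<leftarrow> comult H h, (h1, h2) \<leftarrow> comult H t]. \<phi> a * \<psi> b * \<omega> c)"
    by (simp add: conv_def)
  also have "\<dots> = (\<Sum>(a, b, c)\<leftarrow>comult2 H h. \<phi> a * \<psi> b * \<omega> c)"
    by (rule tensor3_eq_sum_cong[OF _ assms]) (use H in \<open>simp add: hopf_algebra_def\<close>)
  finally show "conv H (conv H \<phi> \<psi>) \<omega> h = conv H \<phi> (conv H \<psi> \<omega>) h"
    by (simp add: sum_comult2)
qed

lemma conv_antipode:
  assumes "algebra_map (scal H) (*) \<chi>"
  shows "functional (\<chi> \<circ> antipode H)" "conv H (\<chi> \<circ> antipode H) \<chi> = counit H"
proof -
  have \<chi>: "functional \<chi>" "\<chi> 1 = 1" "\<And>a b. \<chi> (a * b) = \<chi> a * \<chi> b"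
    using assms by (simp_all add: algebra_map_def)
  have S: "Vector_Spaces.linear (scal H) (scal H) (antipode H)"
    using H by (simp add: hopf_algebra_def)
  show "functional (\<chi> \<circ> antipode H)"
    by (rule linearI) (simp_all add: linearD[OF S] linearD[OF \<chi>(1)])
  show "conv H (\<chi> \<circ> antipode H) \<chi> = counit H"
  proof
    fix h
    have "\<chi> (\<Sum>(h1, h2)\<leftarrow>comult H h. antipode H h1 * h2) = counit H h"
      using H by (simp add: hopf_algebra_def linearD[OF \<chi>(1)] \<chi>(2))
    then show "conv H (\<chi> \<circ> antipode H) \<chi> h = counit H h"
      using tensor_lift_linear_image[OF \<chi>(1), of "\<lambda>a b. antipode H a * b" "comult H h"]
      by (simp add: conv_def tensor_lift_def \<chi>(3))
  qed
qed

text \<open>Apply \<open>\<chi> j\<close> to the compatibility of \<open>g i\<close> with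
  \<open>\<chi> i\<close>. The factor \<open>\<chi> j (g i) = q\<close> cancels and leaves
  \<open>\<chi> i\<close> equal to its conjugate by \<open>\<chi> j\<close>, whose inverse is
  \<open>\<chi> j \<circ> antipode H\<close>.\<close>

lemma conv_realization_commute:
  assumes "principal_yd_realization H q g \<chi>" "q \<noteq> 0"
  shows "conv H (\<chi> i) (\<chi> j) = conv H (\<chi> j) (\<chi> i)"
proof -
  have alg: "algebra_map (scal H) (*) (\<chi> i)" and q: "\<chi> j (g i) = q" for i j
    using assms by (simp_all add: principal_yd_realization_def)
  then have lin: "functional (\<chi> i)" and mult: "\<chi> i (a * b) = \<chi> i a * \<chi> i b" for i a b
    by (simp_all add: algebra_map_def)
  note S = conv_antipode[OF alg[of j]]
  have sum: "\<chi> j (\<Sum>(a, b, c)\<leftarrow>u. f a b c) = (\<Sum>(a, b, c)\<leftarrow>u. \<chi> j (f a b c))"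
    for f and u :: "('h \<times> 'h \<times> 'h) list"
    by (induction u) (auto simp: linearD[OF lin])
  have "\<chi> i = conv H (\<chi> j) (conv H (\<chi> i) (\<chi> j \<circ> antipode H))"
  proof
    fix h
    have "\<chi> j (scal H (\<chi> i h) (g i)) =
      \<chi> j (\<Sum>(h1, h2, h3)\<leftarrow>comult2 H h. scal H (\<chi> i h2) (h1 * g i * antipode H h3))"
      using assms by (simp add: principal_yd_realization_def)
    then have "q * \<chi> i h = (\<Sum>(h1, h2, h3)\<leftarrow>comult2 H h. q * (\<chi> j h1 * \<chi> i h2 * (\<chi> j \<circ> antipode H) h3))"
      by (simp add: sum linearD[OF lin] mult q mult_ac)
    also have "\<dots> = q * conv H (\<chi> j) (conv H (\<chi> i) (\<chi> j \<circ> antipode H)) h"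
      by (simp add: sum_comult2[symmetric] case_prod_unfold sum_list_const_mult)
    finally show "\<chi> i h = conv H (\<chi> j) (conv H (\<chi> i) (\<chi> j \<circ> antipode H)) h"
      using \<open>q \<noteq> 0\<close> by simp
  qed
  then have "conv H (\<chi> i) (\<chi> j) = conv H (conv H (\<chi> j) (conv H (\<chi> i) (\<chi> j \<circ> antipode H))) (\<chi> j)"
    by simp
  also have "\<dots> = conv H (\<chi> j) (\<chi> i)"
    by (simp add: conv_assoc linear_conv lin S conv_counit)
  finally show ?thesis .
qed

end

lemma module_algebra_eigen_mult:
  assumes "module_algebra H s act" "k_algebra s"
    and "\<And>h. act h a = s (\<phi> h) a" "\<And>h. act h b = s (\<psi> h) b"
  shows "act h (a * b) = s (conv H \<phi> \<psi> h) (a * b)"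
proof -
  have "act h (a * b) = tensor_lift (\<lambda>h1 h2. s (\<phi> h1 * \<psi> h2) (a * b)) (comult H h)"
    using assms
    by (simp add: module_algebra_def tensor_lift_def k_algebraD[OF assms(2)]
        scale_laws[OF k_algebraD(1)[OF assms(2)]] mult.commute)
  also have "Vector_Spaces.linear (*) s (\<lambda>c. s c (a * b))"
    by (auto intro!: linearI simp: vector_space_field k_algebraD(1)[OF assms(2)]
        scale_laws[OF k_algebraD(1)[OF assms(2)]])
  note tensor_lift_linear_image[OF this, symmetric]
  finally show ?thesis by (simp add: conv_eq_tensor_lift)
qed

lemma group_like_action_mult:
  assumes "module_algebra H s act" "k_algebra s" "group_like H g"
  shows "act g (a * b) = act g a * act g b" "act g 1 = 1"
proof -
  have act: "Vector_Spaces.linear (scal H) s (\<lambda>h. act h a)" for a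
    using assms by (simp add: module_algebra_def)
  have "bilinear_map (scal H) (scal H) s (\<lambda>h1 h2. act h1 a * act h2 b)"
    by (rule bilinear_mapI; rule linearI)
      (simp_all add: linearD[OF act] k_algebraD[OF assms(2)] algebra_simps)
  from tensor_lift_cong[OF _ this, of "comult H g" "[(g, g)]"] assms
  show "act g (a * b) = act g a * act g b"
    by (simp add: module_algebra_def group_like_def tensor_lift_def)
  show "act g 1 = 1"
    using assms by (simp add: module_algebra_def group_like_def scale_laws[OF k_algebraD(1)[OF assms(2)]])
qed

subsection \<open>The Nichols algebra and its cleft object\<close>

lemma le_2_cases: "n \<le> 2 \<longleftrightarrow> n = 0 \<or> n = 1 \<or> n = (2::nat)"
  by auto

lemma relator_eq:
  assumes "presented_by s \<pi> R" "r - r' \<in> R"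
  shows "\<pi> r = \<pi> r'"
proof -
  have "r - r' \<in> ideal_generated R" using assms(2) by (auto simp: ideal_generated_def)
  then have "\<pi> (r - r') = 0" using assms(1) by (auto simp: presented_by_def)
  moreover have "Vector_Spaces.linear tscale s \<pi>"
    using assms(1) by (simp add: presented_by_def algebra_map_def)
  ultimately show ?thesis by (simp add: linearD)
qed

locale cleft_setting =
  fixes q l1 l2 l12 l112 l122 :: "'k::field"
    and H :: "('k, 'h::ring_1) hopf"
    and g :: "gen \<Rightarrow> 'h" and \<chi> :: "gen \<Rightarrow> 'h \<Rightarrow> 'k"
    and actT :: "'h \<Rightarrow> 'k tensor_algebra \<Rightarrow> 'k tensor_algebra"
    and \<delta>T :: "'k tensor_algebra \<Rightarrow> ('h \<times> 'k tensor_algebra) list"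
    and \<Delta>T :: "'k tensor_algebra \<Rightarrow> ('k tensor_algebra \<times> 'k tensor_algebra) list"
    and sB :: "'k \<Rightarrow> 'b::ring_1 \<Rightarrow> 'b" and \<pi>B :: "'k tensor_algebra \<Rightarrow> 'b"
    and actB :: "'h \<Rightarrow> 'b \<Rightarrow> 'b" and \<delta>B :: "'b \<Rightarrow> ('h \<times> 'b) list"
    and \<Delta>B :: "'b \<Rightarrow> ('b \<times> 'b) list" and \<epsilon>B :: "'b \<Rightarrow> 'k"
    and sE :: "'k \<Rightarrow> 'e::ring_1 \<Rightarrow> 'e" and \<pi>E :: "'k tensor_algebra \<Rightarrow> 'e"
    and actE :: "'h \<Rightarrow> 'e \<Rightarrow> 'e" and \<rho> :: "'e \<Rightarrow> ('e \<times> 'b) list"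
    and \<l> :: "'b \<Rightarrow> 'e" and \<epsilon>0 :: "'e \<Rightarrow> 'k"
    and \<tau>2 :: "'k tensor_algebra \<Rightarrow> 'k tensor_algebra"
    and x :: "gen \<Rightarrow> 'b" and y :: "gen \<Rightarrow> 'e"
  assumes q: "q ^ 3 = 1" "q \<noteq> 1"
    and H: "hopf_algebra H"
    and realization: "principal_yd_realization H q g \<chi>"
    and lambda:
      "l1 \<noteq> 0 \<longrightarrow> conv_power H (\<chi> G1) 3 = counit H"
      "l112 \<noteq> 0 \<longrightarrow> conv H (conv_power H (\<chi> G1) 2) (\<chi> G2) = counit H"
    and TV: "yd_algebra H tscale actT \<delta>T"
      "\<forall>i h. actT h (tgen i) = tscale (\<chi> i h) (tgen i)"
      "\<forall>i. tensor_eq (scal H) tscale (\<delta>T (tgen i)) [(g i, tgen i)]"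
      "braided_algebra_map tscale tscale tscale actT \<delta>T \<Delta>T"
      "\<forall>i. tensor_eq tscale tscale (\<Delta>T (tgen i)) [(tgen i, 1), (1, tgen i)]"
    and B: "presented_by sB \<pi>B (relators q 0 0 0 0 0)" "\<forall>i. x i = \<pi>B (tgen i)"
      "yd_algebra H sB actB \<delta>B"
      "\<forall>i h. actB h (x i) = sB (\<chi> i h) (x i)"
      "\<forall>i. tensor_eq (scal H) sB (\<delta>B (x i)) [(g i, x i)]"
      "braided_algebra_map sB sB sB actB \<delta>B \<Delta>B"
      "\<forall>i. tensor_eq sB sB (\<Delta>B (x i)) [(x i, 1), (1, x i)]"
      "algebra_map sB (*) \<epsilon>B" "\<forall>i. \<epsilon>B (x i) = 0"
    and E: "presented_by sE \<pi>E (relators q l1 l2 l12 l112 l122)" "\<forall>i. y i = \<pi>E (tgen i)"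
      "module_algebra H sE actE"
      "\<forall>i h. actE h (y i) = sE (\<chi> i h) (y i)"
      "braided_algebra_map sE sE sB actE \<delta>B \<rho>"
      "\<forall>i. tensor_eq sE sB (\<rho> (y i)) [(y i, 1), (1, x i)]"
    and ell: "Vector_Spaces.linear sB sE \<l>" "bij \<l>"
      "\<forall>n2\<le>2. \<forall>n12\<le>2. \<forall>n1\<le>2. \<l> (pbw sB q x n2 n12 n1) = pbw sE q y n2 n12 n1"
    and eps0: "Vector_Spaces.linear sE (*) \<epsilon>0" "\<epsilon>0 \<circ> \<l> = \<epsilon>B"
    and tau2: "projection_onto_along tscale \<tau>2 {t. \<pi>B t = 0}
      (module.span tscale {pbw tscale q tgen n2 n12 n1 | n2 n12 n1. n2 \<le> 2 \<and> n12 \<le> 2 \<and> n1 \<le> 2})"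
begin

abbreviation "X \<equiv> pbw sB q x"
abbreviation "Y \<equiv> pbw sE q y"
abbreviation "x12 \<equiv> q_bracket sB q (x G1) (x G2)"
abbreviation "y12 \<equiv> q_bracket sE q (y G1) (y G2)"
abbreviation "word_T w \<equiv> prod_list (map (tgen :: gen \<Rightarrow> 'k tensor_algebra) w)"
abbreviation "word_B w \<equiv> prod_list (map x w)"
abbreviation "word_E w \<equiv> prod_list (map y w)"

lemma algebras: "k_algebra (tscale :: 'k \<Rightarrow> _)" "k_algebra sB" "k_algebra sE"
  using TV(1) B(1) E(1) by (simp_all add: yd_algebra_def presented_by_def)

lemmas spaces = algebras[THEN k_algebraD(1)]
lemmas scale_simps_B = scale_laws[OF spaces(2)] k_algebraD(2,3)[OF algebras(2)]
lemmas scale_simps_E = scale_laws[OF spaces(3)] k_algebraD(2,3)[OF algebras(3)]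

lemma projections: "algebra_map tscale sB \<pi>B" "algebra_map tscale sE \<pi>E" "surj \<pi>B" "surj \<pi>E"
  using B(1) E(1) by (simp_all add: presented_by_def)

lemma projections_linear:
  "Vector_Spaces.linear tscale sB \<pi>B" "Vector_Spaces.linear tscale sE \<pi>E"
  using projections by (simp_all add: algebra_map_def)

lemma projections_mult:
  "\<pi>B (s * t) = \<pi>B s * \<pi>B t" "\<pi>E (s * t) = \<pi>E s * \<pi>E t" "\<pi>B 1 = 1" "\<pi>E 1 = 1"
  using projections by (simp_all add: algebra_map_def)

lemma projections_power: "\<pi>B (t ^ n) = \<pi>B t ^ n" "\<pi>E (t ^ n) = \<pi>E t ^ n"
  by (induction n) (simp_all add: projections_mult)

lemma projections_bracket:
  "\<pi>B (q_bracket tscale c s t) = q_bracket sB c (\<pi>B s) (\<pi>B t)"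
  "\<pi>E (q_bracket tscale c s t) = q_bracket sE c (\<pi>E s) (\<pi>E t)"
  by (simp_all add: q_bracket_def linearD[OF projections_linear(1)] linearD[OF projections_linear(2)]
      projections_mult)

lemma projections_pbw:
  "\<pi>B (pbw tscale q tgen n2 n12 n1) = X n2 n12 n1" "\<pi>E (pbw tscale q tgen n2 n12 n1) = Y n2 n12 n1"
  using B(2) E(2)
  by (simp_all add: pbw_def projections_mult projections_power projections_bracket)

lemma projections_word: "\<pi>B (word_T w) = word_B w" "\<pi>E (word_T w) = word_E w"
  using algebra_map_prod_list[OF projections(1)] algebra_map_prod_list[OF projections(2)] B(2) E(2)
  by (simp_all cong: map_cong)

lemma relations_B: "x G2 ^ 3 = 0" "x12 * x G2 = sB (q\<^sup>2) (x G2 * x12)"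
proof -
  note rel = relator_eq[OF B(1)]
  note simps = projections_power projections_bracket projections_mult
    linearD[OF projections_linear(1)] scale_simps_B
  have "\<pi>B (tgen G2 ^ 3) = \<pi>B (tscale 0 1)" by (rule rel) (simp add: relators_def Let_def)
  then show "x G2 ^ 3 = 0" using B(2) by (simp add: simps)
  have "\<pi>B (q_bracket tscale (q\<^sup>2) (q_bracket tscale q (tgen G1) (tgen G2)) (tgen G2)) = \<pi>B (tscale 0 1)"
    by (rule rel) (simp add: relators_def Let_def)
  then have "q_bracket sB (q\<^sup>2) x12 (x G2) = 0" using B(2) by (simp add: simps)
  then show "x12 * x G2 = sB (q\<^sup>2) (x G2 * x12)" by (simp add: q_bracket_def[of sB "q\<^sup>2"])
qed

lemma relations_E:
  "y G1 ^ 3 = sE l1 1" "y12 ^ 3 = sE l12 1" "y G1 * y12 = sE (q\<^sup>2) (y12 * y G1) + sE l112 1"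
proof -
  note rel = relator_eq[OF E(1)]
  note simps = projections_power projections_bracket projections_mult
    linearD[OF projections_linear(2)] scale_simps_E
  have "\<pi>E (tgen G1 ^ 3) = \<pi>E (tscale l1 1)" by (rule rel) (simp add: relators_def Let_def)
  then show "y G1 ^ 3 = sE l1 1" using E(2) by (simp add: simps)
  have "\<pi>E (q_bracket tscale q (tgen G1) (tgen G2) ^ 3) = \<pi>E (tscale l12 1)"
    by (rule rel) (simp add: relators_def Let_def)
  then show "y12 ^ 3 = sE l12 1" using E(2) by (simp add: simps)
  have "\<pi>E (q_bracket tscale (q\<^sup>2) (tgen G1) (q_bracket tscale q (tgen G1) (tgen G2))) = \<pi>E (tscale l112 1)"
    by (rule rel) (simp add: relators_def Let_def)
  then have "q_bracket sE (q\<^sup>2) (y G1) y12 = sE l112 1" using E(2) by (simp add: simps)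
  then show "y G1 * y12 = sE (q\<^sup>2) (y12 * y G1) + sE l112 1"
    by (simp add: q_bracket_def[of sE "q\<^sup>2"] algebra_simps)
qed

lemma q_facts: "q \<noteq> 0" "q\<^sup>2 = - 1 - q"
proof -
  show "q \<noteq> 0" using q(1) by auto
  have "(q - 1) * (q\<^sup>2 + q + 1) = 0"
    using q(1) by (simp add: algebra_simps power2_eq_square power3_eq_cube)
  then have "q\<^sup>2 + q + 1 = 0" using q(2) by simp
  then show "q\<^sup>2 = - 1 - q" by (simp add: eq_neg_iff_add_eq_0 eq_diff_eq add_ac)
qed

text \<open>Rewrite rules that lower polynomials in \<open>q\<close> to degree at most one; the
  second form reaches squares inside right-nested products.\<close>

lemma q_square: "q * q = - 1 - q" "q * (q * c) = (- 1 - q) * c"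
  using q_facts(2) by (simp_all add: power2_eq_square flip: mult.assoc)

lemma tau2_facts:
  "Vector_Spaces.linear tscale tscale \<tau>2" "\<pi>B (\<tau>2 t) = 0" "\<tau>2 (\<tau>2 t) = \<tau>2 t"
  "\<tau>2 t = 0 \<longleftrightarrow> t \<in> module.span tscale
    {pbw tscale q tgen n2 n12 n1 | n2 n12 n1. n2 \<le> 2 \<and> n12 \<le> 2 \<and> n1 \<le> 2}"
proof -
  show lin: "Vector_Spaces.linear tscale tscale \<tau>2"
    using tau2 by (simp add: projection_onto_along_def)
  have "\<tau>2 t \<in> {t. \<pi>B t = 0}" using tau2 by (auto simp: projection_onto_along_def)
  then show "\<pi>B (\<tau>2 t) = 0" by simp
  then show "\<tau>2 (\<tau>2 t) = \<tau>2 t" using tau2 by (simp add: projection_onto_along_def)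
  show "\<tau>2 t = 0 \<longleftrightarrow> t \<in> module.span tscale
    {pbw tscale q tgen n2 n12 n1 | n2 n12 n1. n2 \<le> 2 \<and> n12 \<le> 2 \<and> n1 \<le> 2}"
    using tau2 by (auto simp: projection_onto_along_def)
qed

text \<open>The spanning half of the PBW theorem is contained in the existence of
  \<open>\<tau>2\<close>: \<open>t - \<tau>2 t\<close> has the same image as \<open>t\<close> in the
  Nichols algebra and lies in the span of the monomials in \<open>T(V)\<close>.\<close>

lemma pbw_spans: "module.span sB {X n2 n12 n1 | n2 n12 n1. n2 \<le> 2 \<and> n12 \<le> 2 \<and> n1 \<le> 2} = UNIV"
proof -
  interpret \<pi>: Vector_Spaces.linear tscale sB \<pi>B by (rule projections_linear)
  let ?W = "{pbw tscale q tgen n2 n12 n1 | n2 n12 n1. n2 \<le> 2 \<and> n12 \<le> 2 \<and> n1 \<le> (2::nat)}"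
  have "\<pi>B ` ?W = {X n2 n12 n1 | n2 n12 n1. n2 \<le> 2 \<and> n12 \<le> 2 \<and> n1 \<le> 2}"
    unfolding image_Collect using projections_pbw(1) by (intro Collect_cong) metis
  then have span: "\<pi>.vs2.span {X n2 n12 n1 | n2 n12 n1. n2 \<le> 2 \<and> n12 \<le> 2 \<and> n1 \<le> 2} =
      \<pi>B ` \<pi>.vs1.span ?W"
    using \<pi>.span_image[of ?W] by simp
  have "b \<in> \<pi>B ` \<pi>.vs1.span ?W" for b
  proof -
    obtain t where t: "b = \<pi>B t" using projections(3) by auto
    have "\<tau>2 (t - \<tau>2 t) = 0" by (simp add: linearD[OF tau2_facts(1)] tau2_facts(3))
    moreover have "\<pi>B (t - \<tau>2 t) = b" by (simp add: t \<pi>.diff tau2_facts(2))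
    ultimately show ?thesis using tau2_facts(4) by blast
  qed
  then show ?thesis using span by auto
qed

lemma finite_pbw: "finite {X n2 n12 n1 | n2 n12 n1. n2 \<le> 2 \<and> n12 \<le> 2 \<and> n1 \<le> 2}"
proof -
  have "{X n2 n12 n1 | n2 n12 n1. n2 \<le> 2 \<and> n12 \<le> 2 \<and> n1 \<le> 2} =
      (\<lambda>(n2, n12, n1). X n2 n12 n1) ` ({..2} \<times> {..2} \<times> {..2})"
    by (force simp: image_iff)
  then show ?thesis by simp
qed

lemma linear_eq_on_pbw:
  assumes "Vector_Spaces.linear sB s f" "Vector_Spaces.linear sB s f'"
    and "\<And>n2 n12 n1. n2 \<le> 2 \<Longrightarrow> n12 \<le> 2 \<Longrightarrow> n1 \<le> 2 \<Longrightarrow> f (X n2 n12 n1) = f' (X n2 n12 n1)"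
  shows "f = f'"
  by (rule linear_eq_on_spanning[OF assms(1,2) pbw_spans]) (use assms(3) in auto)

lemma linear_eq_on_pbw_E:
  assumes f: "Vector_Spaces.linear sE s f" "Vector_Spaces.linear sE s f'"
    and "\<And>n2 n12 n1. n2 \<le> 2 \<Longrightarrow> n12 \<le> 2 \<Longrightarrow> n1 \<le> 2 \<Longrightarrow> f (Y n2 n12 n1) = f' (Y n2 n12 n1)"
  shows "f = f'"
proof -
  have "(\<lambda>b. f (\<l> b)) = (\<lambda>b. f' (\<l> b))"
  proof (rule linear_eq_on_pbw[of s])
    show "Vector_Spaces.linear sB s (\<lambda>b. f (\<l> b))" "Vector_Spaces.linear sB s (\<lambda>b. f' (\<l> b))"
      using linear_comp[OF ell(1)] f by auto
  qed (use assms(3) ell(3) in simp)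
  then show ?thesis using bij_is_surj[OF ell(2)] by (metis surj_def ext)
qed

section \<open>Augmentations, group-like actions and coproducts of words\<close>

lemma epsB_mult: "Vector_Spaces.linear sB (*) \<epsilon>B" "\<epsilon>B (a * b) = \<epsilon>B a * \<epsilon>B b" "\<epsilon>B 1 = 1"
  using B(8) by (simp_all add: algebra_map_def)

lemma epsB_X: "\<epsilon>B (X n2 n12 n1) = (if n2 = 0 \<and> n12 = 0 \<and> n1 = 0 then 1 else 0)"
proof -
  have "\<epsilon>B (b ^ n) = \<epsilon>B b ^ n" for b n
    by (induction n) (simp_all add: epsB_mult)
  then show ?thesis
    using B(9) by (simp add: pbw_def epsB_mult q_bracket_def linearD[OF epsB_mult(1)])
qed

lemma epsB_word: "\<epsilon>B (word_B w) = (if w = [] then 1 else 0)"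
  using B(9) by (cases w) (simp_all add: epsB_mult)

lemma eps0_Y:
  assumes "n2 \<le> 2" "n12 \<le> 2" "n1 \<le> 2"
  shows "\<epsilon>0 (Y n2 n12 n1) = (if n2 = 0 \<and> n12 = 0 \<and> n1 = 0 then 1 else 0)"
proof -
  have "\<epsilon>0 (Y n2 n12 n1) = \<epsilon>B (X n2 n12 n1)"
    using ell(3) assms eps0(2) by (metis comp_apply)
  then show ?thesis by (simp add: epsB_X)
qed

lemma group_likes: "group_like H (g i)" "\<chi> j (g i) = q"
  using realization by (simp_all add: principal_yd_realization_def)

lemma modules: "module_algebra H tscale actT" "module_algebra H sB actB"
  using TV(1) B(3) by (simp_all add: yd_algebra_def)

lemma action_group_like_word:
  assumes "module_algebra H s act" "k_algebra s" "\<And>i h. act h (z i) = s (\<chi> i h) (z i)"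
  shows "act (g i) (prod_list (map z w)) = s (q ^ length w) (prod_list (map z w))"
  by (induction w)
    (simp_all add: group_like_action_mult[OF assms(1,2) group_likes(1)] assms(3) group_likes(2)
      scale_laws[OF k_algebraD(1)[OF assms(2)]] k_algebraD[OF assms(2)] mult.commute)

lemma comodules:
  "tensor_linear tscale (scal H) tscale \<delta>T" "tensor_eq (scal H) tscale (\<delta>T 1) [(1, 1)]"
  "tensor_linear sB (scal H) sB \<delta>B" "tensor_eq (scal H) sB (\<delta>B 1) [(1, 1)]"
  using TV(1) B(3) by (simp_all add: yd_algebra_def comodule_algebra_def)

lemma comult_T_word:
  assumes "bilinear_map tscale tscale s \<beta>"
  shows "tensor_lift \<beta> (\<Delta>T (word_T w)) = word_comult_sum s q (\<lambda>u v. \<beta> (word_T u) (word_T v)) w"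
  by (rule tensor_lift_word[OF TV(4) algebras(1) modules(1) _ algebras(1) comodules(1,2) _ _ assms])
    (use TV(2,3,5) in \<open>auto intro: action_group_like_word[OF modules(1) algebras(1)]\<close>)

lemma comult_B_word:
  assumes "bilinear_map sB sB s \<beta>"
  shows "tensor_lift \<beta> (\<Delta>B (word_B w)) = word_comult_sum s q (\<lambda>u v. \<beta> (word_B u) (word_B v)) w"
  by (rule tensor_lift_word[OF B(6) algebras(2) modules(2) _ algebras(2) comodules(3,4) _ _ assms])
    (use B(4,5,7) in \<open>auto intro: action_group_like_word[OF modules(2) algebras(2)]\<close>)

lemma coaction_E_word:
  assumes "bilinear_map sE sB s \<beta>"
  shows "tensor_lift \<beta> (\<rho> (word_E w)) = word_comult_sum s q (\<lambda>u v. \<beta> (word_E u) (word_B v)) w"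
  by (rule tensor_lift_word[OF E(5) algebras(3) E(3) _ algebras(2) comodules(3,4) _ _ assms])
    (use E(4,6) B(5) in \<open>auto intro: action_group_like_word[OF E(3) algebras(3)]\<close>)

lemma linear_eq_on_words_B:
  assumes "Vector_Spaces.linear sB s f" "Vector_Spaces.linear sB s f'"
    and "\<And>w. f (word_B w) = f' (word_B w)"
  shows "f = f'"
proof
  fix b
  obtain t where "b = \<pi>B t" using projections(3) by auto
  moreover have "f (\<pi>B t) = f' (\<pi>B t)"
    by (rule linear_eq_on_words[where s = s])
      (simp_all add: linear_comp[OF projections_linear(1)] assms projections_word)
  ultimately show "f b = f' b" by simp
qed

lemma linear_eq_on_words_E:
  assumes "Vector_Spaces.linear sE s f" "Vector_Spaces.linear sE s f'"
    and "\<And>w. f (word_E w) = f' (word_E w)"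
  shows "f = f'"
proof
  fix b
  obtain t where "b = \<pi>E t" using projections(4) by auto
  moreover have "f (\<pi>E t) = f' (\<pi>E t)"
    by (rule linear_eq_on_words[where s = s])
      (simp_all add: linear_comp[OF projections_linear(2)] assms projections_word)
  ultimately show "f b = f' b" by simp
qed

subsection \<open>The comodule map induced by \<open>\<epsilon>\<^sub>0\<close>\<close>

lemma action_group_like_mult:
  assumes "actE (g i) p = sE (q ^ d) p"
  shows "actE (g i) (p * y j) = sE (q ^ Suc d) (p * y j)"
    and "actE (g i) (p * y12) = sE (q ^ (d + 2)) (p * y12)"
proof -
  note simps = group_like_action_mult[OF E(3) algebras(3) group_likes(1)] scale_simps_E group_likes(2)
  have lin: "Vector_Spaces.linear sE sE (actE h)" for h
    using E(3) by (simp add: module_algebra_def)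
  have y: "actE (g i) (p * y j) = sE (q ^ Suc d) (p * y j)" if "actE (g i) p = sE (q ^ d) p" for p d j
    using that E(4) by (simp add: simps mult.commute)
  then show "actE (g i) (p * y j) = sE (q ^ Suc d) (p * y j)" using assms .
  have "p * y12 = p * y G1 * y G2 - sE q (p * y G2 * y G1)"
    by (simp add: q_bracket_def simps algebra_simps)
  moreover have "actE (g i) (p * y G1 * y G2 - sE q (p * y G2 * y G1)) =
      sE (q ^ (d + 2)) (p * y G1 * y G2 - sE q (p * y G2 * y G1))"
    by (simp add: linearD[OF lin] y[OF y[OF assms]] scale_simps_E) (simp add: mult_ac)
  ultimately show "actE (g i) (p * y12) = sE (q ^ (d + 2)) (p * y12)" by simp
qed

lemma action_group_like_Y: "actE (g i) (Y n2 n12 n1) = sE (q ^ (n2 + 2 * n12 + n1)) (Y n2 n12 n1)"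
proof -
  have "actE (g i) (y G2 ^ n) = sE (q ^ n) (y G2 ^ n)" for n
  proof (induction n)
    case 0
    show ?case by (simp add: group_like_action_mult[OF E(3) algebras(3) group_likes(1)] scale_simps_E)
  next
    case (Suc n)
    from action_group_like_mult(1)[OF this, of G2] show ?case by (simp add: power_commutes)
  qed
  then have "actE (g i) (y G2 ^ n2 * y12 ^ n) = sE (q ^ (n2 + 2 * n)) (y G2 ^ n2 * y12 ^ n)" for n
  proof (induction n)
    case (Suc n)
    from action_group_like_mult(2)[OF Suc.IH[OF Suc.prems]] show ?case
      by (simp add: power_Suc2 mult.assoc del: power_Suc)
  qed simp
  then have "actE (g i) (y G2 ^ n2 * y12 ^ n12 * y G1 ^ n) =
      sE (q ^ (n2 + 2 * n12 + n)) (y G2 ^ n2 * y12 ^ n12 * y G1 ^ n)" for n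
  proof (induction n)
    case (Suc n)
    from action_group_like_mult(1)[OF Suc.IH[OF Suc.prems]] show ?case
      by (simp add: power_Suc2 mult.assoc del: power_Suc)
  qed simp
  then show ?thesis by (simp add: pbw_def)
qed

text \<open>\<open>g i\<close> scales a PBW monomial by \<open>q\<close> to its degree, and
  \<open>\<epsilon>0\<close> vanishes on all of them except the one of degree 0.\<close>

lemma eps0_action_group_like: "\<epsilon>0 (actE (g i) e) = \<epsilon>0 e"
proof -
  have lin: "Vector_Spaces.linear sE sE (actE h)" for h
    using E(3) by (simp add: module_algebra_def)
  have "(\<lambda>e. \<epsilon>0 (actE (g i) e)) = \<epsilon>0"
    by (rule linear_eq_on_pbw_E[OF linear_comp[OF lin eps0(1)] eps0(1)])
      (simp add: action_group_like_Y linearD[OF eps0(1)] eps0_Y)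
  then show ?thesis by (rule fun_cong)
qed

text \<open>\<open>p * actE (g i) e\<close> is \<open>q ^ (- d)\<close> times the action of
  \<open>g i\<close> on \<open>p * e\<close>, which \<open>\<epsilon>0\<close> does not see;
  \<open>q ^ 3 = 1\<close> turns \<open>- d\<close> into \<open>2 * d\<close>.\<close>

lemma eps0_twist:
  assumes "actE (g i) p = sE (q ^ d) p"
  shows "\<epsilon>0 (p * actE (g i) e) = q ^ (2 * d) * \<epsilon>0 (p * e)"
proof -
  have "q ^ d * q ^ (2 * d) = 1"
    using q(1) by (simp flip: power_add power_mult add: power_mult[of q 3])
  then have "\<epsilon>0 (p * actE (g i) e) = q ^ (2 * d) * \<epsilon>0 (actE (g i) (p * e))"
    by (simp add: group_like_action_mult[OF E(3) algebras(3) group_likes(1)] assms scale_simps_E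
        linearD[OF eps0(1)] mult.assoc[symmetric] mult.commute)
  then show ?thesis by (simp add: eps0_action_group_like)
qed

text \<open>
  \<open>K 1\<close> is the comodule map \<open>\<theta>\<close> below; allowing a factor \<open>p\<close> gives recursions for \<open>K\<close> along the
  letters of the second argument.
\<close>

definition K :: "'e \<Rightarrow> 'e \<Rightarrow> 'b" where
  "K p e = tensor_lift (\<lambda>e0 b. sB (\<epsilon>0 (p * e0)) b) (\<rho> e)"

lemma K_bilinear: "bilinear_map sE sB sB (\<lambda>e0 b. sB (\<epsilon>0 (p * e0)) b)"
  using bilinear_map_compose[OF linear_comp[OF linear_mult(1)[OF algebras(3)] eps0(1)] _
      bilinear_map_scale(1)[OF spaces(2)], of sB "\<lambda>b. b"]
  by (simp add: linearI spaces)

lemma K_linear: "Vector_Spaces.linear sE sB (K p)"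
  unfolding K_def
  by (rule tensor_lift_linear[OF _ K_bilinear spaces(3)]) (use E(5) in \<open>simp add: braided_algebra_map_def\<close>)

lemma K_linear_left: "Vector_Spaces.linear sE sB (\<lambda>p. K p e)"
  unfolding K_def tensor_lift_def
  by (rule linear_sum_list[OF spaces(3,2)])
    (auto intro!: linearI simp: spaces linearD[OF eps0(1)] scale_simps_E scale_simps_B distrib_right)

lemma K_1: "K p 1 = sB (\<epsilon>0 p) 1"
proof -
  have "tensor_eq sE sB (\<rho> 1) [(1, 1)]" using E(5) by (simp add: braided_algebra_map_def)
  from tensor_lift_cong[OF this K_bilinear] show ?thesis by (simp add: K_def)
qed

text \<open>The part \<open>y i * e0 \<otimes> b\<close> of the coaction absorbs the letter into the
  left factor \<open>p\<close>. In the part where \<open>g i\<close> acts on \<open>e0\<close>,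
  \<open>eps0_twist\<close> removes the action at the price of \<open>q ^ (2 * d)\<close>.\<close>

lemma K_generator:
  assumes "\<And>i. actE (g i) p = sE (q ^ d) p"
  shows "K p (y i * e) = K (p * y i) e + sB (q ^ (2 * d)) (x i * K p e)"
proof -
  have "K p (y i * e) = tensor_lift (\<lambda>e0 b. sB (\<epsilon>0 (p * (y i * e0))) b
      + sB (\<epsilon>0 (p * actE (g i) e0)) (x i * b)) (\<rho> e)"
    unfolding K_def
    by (rule tensor_lift_braided_mult_generator[OF E(5) algebras(3) E(3) algebras(2) comodules(3,4) _ _ K_bilinear])
      (use B(5) E(6) in auto)
  also have "\<dots> = K (p * y i) e + tensor_lift (\<lambda>e0 b. sB (q ^ (2 * d)) (x i * sB (\<epsilon>0 (p * e0)) b)) (\<rho> e)"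
    by (simp add: tensor_lift_add K_def eps0_twist[OF assms] scale_simps_B mult.assoc)
  also have "Vector_Spaces.linear sB sB (\<lambda>b. sB (q ^ (2 * d)) (x i * b))"
    by (auto intro!: linearI simp: spaces scale_simps_B distrib_left mult.commute)
  note tensor_lift_linear_image[OF this, symmetric]
  finally show ?thesis by (simp add: K_def)
qed

text \<open>Expand both terms of \<open>y12\<close> by \<open>K_generator\<close>. The multiples of
  \<open>x G1 * K (p * y G2) e\<close> have coefficient \<open>q^(2d) - q^(2d+3) = 0\<close>; those
  of \<open>x G2 * K (p * y G1) e\<close> have
  \<open>q^(2d+2) - q^(2d+1) = (1 - q^2) q^(2d+2)\<close>.\<close>

lemma K_y12:
  assumes p: "\<And>i. actE (g i) p = sE (q ^ d) p"
  shows "K p (y12 * e) = K (p * y12) e + sB (q ^ (4 * d)) (x12 * K p e)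
    + sB ((1 - q\<^sup>2) * q ^ (2 * d + 2)) (x G2 * K (p * y G1) e)"
proof -
  note gen = K_generator[OF p] K_generator[OF action_group_like_mult(1)[OF p]]
  note lin = linearD[OF K_linear] linearD[OF K_linear_left]
  have 1: "y12 * e = y G1 * (y G2 * e) - sE q (y G2 * (y G1 * e))"
    by (simp add: q_bracket_def scale_simps_E algebra_simps)
  have 2: "p * y12 = p * y G1 * y G2 - sE q (p * y G2 * y G1)"
    by (simp add: q_bracket_def scale_simps_E algebra_simps)
  have 3: "x12 * K p e = x G1 * (x G2 * K p e) - sB q (x G2 * (x G1 * K p e))"
    by (simp add: q_bracket_def scale_simps_B algebra_simps)
  have q3: "q * (q * (q * c)) = c" for c
    using q(1) by (simp add: power3_eq_cube mult.assoc[symmetric])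
  have q4: "q ^ (4 * d) = q ^ (2 * d) * q ^ (2 * d)" by (simp flip: power_add)
  show ?thesis
    unfolding 1 2 3 q4
    by (simp add: lin gen scale_simps_B distrib_left power2_eq_square algebra_simps q3)
qed

section \<open>Left factors in PBW form and the values of the comodule map\<close>

lemma Y_mult:
  assumes "n12 \<le> 2"
  shows "Y n2 n12 n1 * y G1 = (if n1 = 2 then sE l1 (Y n2 n12 0) else Y n2 n12 (Suc n1))"
    and "Y n2 n12 0 * y12 = (if n12 = 2 then sE l12 (Y n2 0 0) else Y n2 (Suc n12) 0)"
    and "Y n2 n12 1 * y12 =
      sE (q\<^sup>2) (if n12 = 2 then sE l12 (Y n2 0 1) else Y n2 (Suc n12) 1) + sE l112 (Y n2 n12 0)"
    and "Y n2 n12 2 * y12 =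
      sE q (if n12 = 2 then sE l12 (Y n2 0 2) else Y n2 (Suc n12) 2) - sE (q * l112) (Y n2 n12 1)"
proof -
  note simps = pbw_def scale_simps_E distrib_left distrib_right mult.assoc
  have y1: "y G1 ^ n1 * y G1 = (if n1 = 2 then sE l1 1 else y G1 ^ Suc n1)"
    using relations_E(1) by (simp add: power2_eq_square power3_eq_cube power_commutes mult.assoc)
  have "y12 * (y12 * (y12 * z)) = y12 ^ 3 * z" for z
    by (simp add: power3_eq_cube mult.assoc)
  then have y12: "y12 ^ n12 * (y12 * z) = (if n12 = 2 then sE l12 z else y12 ^ Suc n12 * z)" for z
    using relations_E(2) by (simp add: power2_eq_square power_Suc2 mult.assoc scale_simps_E del: power_Suc)
  have q4: "q ^ 4 = q" using q(1) by (simp add: power_numeral_reduce mult.assoc)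
  show "Y n2 n12 n1 * y G1 = (if n1 = 2 then sE l1 (Y n2 n12 0) else Y n2 n12 (Suc n1))"
    unfolding pbw_def mult.assoc y1 by (simp add: scale_simps_E)
  show "Y n2 n12 0 * y12 = (if n12 = 2 then sE l12 (Y n2 0 0) else Y n2 (Suc n12) 0)"
    using y12[of 1] by (simp add: pbw_def mult.assoc scale_simps_E)
  show "Y n2 n12 1 * y12 =
      sE (q\<^sup>2) (if n12 = 2 then sE l12 (Y n2 0 1) else Y n2 (Suc n12) 1) + sE l112 (Y n2 n12 0)"
    using y12[of "y G1"] by (simp add: pbw_def relations_E(3) simps)
  have "y G1 * (y G1 * y12) = y G1 * (sE (q\<^sup>2) (y12 * y G1) + sE l112 1)"
    by (simp only: relations_E(3))
  also have "\<dots> = sE (q\<^sup>2) ((y G1 * y12) * y G1) + sE l112 (y G1)"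
    by (simp add: distrib_left scale_simps_E mult.assoc)
  also have "\<dots> = sE q (y12 * (y G1)\<^sup>2) + sE (q\<^sup>2 * l112 + l112) (y G1)"
    unfolding relations_E(3)
    by (simp add: distrib_left distrib_right scale_simps_E mult.assoc q4 power2_eq_square[of "y G1"])
  \<comment> \<open>Moving \<open>y12\<close> past two letters \<open>y G1\<close> leaves
    \<open>l112\<close> once per letter, with weights \<open>1\<close> and \<open>q^2\<close>; their
    sum is \<open>- q\<close>.\<close>
  also have "q\<^sup>2 * l112 + l112 = - (q * l112)"
    by (simp add: q_facts(2) algebra_simps)
  finally have "(y G1)\<^sup>2 * y12 = sE q (y12 * (y G1)\<^sup>2) - sE (q * l112) (y G1)"
    by (simp add: power2_eq_square[of "y G1"] mult.assoc scale_simps_E)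
  then show "Y n2 n12 2 * y12 =
      sE q (if n12 = 2 then sE l12 (Y n2 0 2) else Y n2 (Suc n12) 2) - sE (q * l112) (Y n2 n12 1)"
    using y12[of "(y G1)\<^sup>2"] by (simp add: pbw_def mult.assoc right_diff_distrib scale_simps_E)
qed

text \<open>Right multiplication by \<open>y G1\<close> affects only the exponent \<open>n1\<close>.
  A factor \<open>y G2\<close> or \<open>y12\<close> in the left leg therefore never disappears, and
  \<open>\<epsilon>0\<close> is always evaluated at a monomial other than 1.\<close>

lemma K_Y_y1_power:
  assumes "0 < n2 + n12" "n2 \<le> 2" "n12 \<le> 2" "n1 \<le> 2"
  shows "K (Y n2 n12 n1) (y G1 ^ c) = 0"
  using assms(4)
proof (induction c arbitrary: n1)
  case 0
  then show ?case using assms by (auto simp: K_1 eps0_Y scale_simps_B)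
next
  case (Suc c)
  then have "n1 = 2 \<or> Suc n1 \<le> 2" by auto
  then show ?case
    by (auto simp: K_generator[OF action_group_like_Y] Y_mult[OF assms(3)] Suc linearD[OF K_linear_left]
        scale_simps_B)
qed

text \<open>Absorbing \<open>y12\<close> may lower the exponent \<open>n12\<close> through
  \<open>l12\<close>, and an exchange with \<open>y G1\<close> may lose a \<open>y12\<close> through
  \<open>l112\<close>, but \<open>Y_mult\<close> never touches \<open>n2\<close>. This is why
  positivity is now asked of \<open>n2\<close> alone.\<close>

lemma K_Y_subalgebra:
  assumes "0 < n2" "n2 \<le> 2" "n12 \<le> 2" "n1 \<le> 2"
  shows "K (Y n2 n12 n1) (y12 ^ b * y G1 ^ c) = 0"
  using assms(3,4)
proof (induction b arbitrary: n12 n1)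
  case 0
  then show ?case using assms by (simp add: K_Y_y1_power)
next
  case (Suc b)
  have "K (Y n2 n12 n1 * y12) (y12 ^ b * y G1 ^ c) = 0"
  proof -
    have "n1 = 0 \<or> n1 = 1 \<or> n1 = 2" "n12 = 2 \<or> n12 \<noteq> 2 \<and> Suc n12 \<le> 2" using Suc.prems by auto
    then show ?thesis
      using Y_mult(2-4)[OF Suc.prems(1), of n2]
      by (elim disjE) (simp_all add: Suc.IH linearD[OF K_linear_left] scale_simps_B)
  qed
  moreover have "K (Y n2 n12 n1 * y G1) (y12 ^ b * y G1 ^ c) = 0"
  proof -
    have "n1 = 2 \<or> Suc n1 \<le> 2" using Suc.prems by auto
    then show ?thesis using Suc.prems(1)
      by (auto simp: Y_mult[OF Suc.prems(1)] Suc.IH linearD[OF K_linear_left] scale_simps_B)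
  qed
  ultimately show ?case
    by (simp add: K_y12[OF action_group_like_Y] Suc.IH[OF Suc.prems] scale_simps_B mult.assoc)
qed

definition \<theta> :: "'e \<Rightarrow> 'b" where
  "\<theta> e = tensor_lift (\<lambda>e0 b. sB (\<epsilon>0 e0) b) (\<rho> e)"

lemma theta_eq_K: "\<theta> e = K (Y 0 0 0) e"
  by (simp add: \<theta>_def K_def pbw_def)

lemma theta_linear: "Vector_Spaces.linear sE sB \<theta>"
  using K_linear by (simp add: theta_eq_K[abs_def])

text \<open>A letter \<open>y G2\<close> absorbed into the left leg is killed by
  \<open>K_Y_subalgebra\<close>, so a leading \<open>y G2\<close> can only turn into
  \<open>x G2\<close>.\<close>

lemma theta_y2_power:
  assumes "n \<le> 2"
  shows "\<theta> (y G2 ^ n * (y12 ^ b * y G1 ^ c)) = x G2 ^ n * \<theta> (y12 ^ b * y G1 ^ c)"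
proof -
  let ?e = "y12 ^ b * y G1 ^ c"
  have Y2: "Y n 0 0 * y G2 = Y (Suc n) 0 0" for n by (simp add: pbw_def power_commutes)
  have 0: "K (Y (Suc 0) 0 0) ?e = 0" "K (Y (Suc (Suc 0)) 0 0) ?e = 0"
    by (simp_all add: K_Y_subalgebra)
  have 1: "\<theta> (y G2 * ?e) = x G2 * \<theta> ?e"
    by (simp add: theta_eq_K K_generator[OF action_group_like_Y] Y2 0 scale_simps_B)
  have "\<theta> (y G2 * (y G2 * ?e)) = x G2 * (x G2 * \<theta> ?e)"
    using 1 by (simp add: theta_eq_K K_generator[OF action_group_like_Y] Y2 0 scale_simps_B)
  with 1 assms show ?thesis
    by (auto simp: le_2_cases power2_eq_square mult.assoc)
qed

text \<open>Base values of the recursion: left factors \<open>1\<close>, \<open>y G1\<close>,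
  \<open>y G1 ^ 2\<close> against powers of \<open>y G1\<close>. In the last value the recursion
  gives \<open>l1 + q ^ 4 * l1\<close>, and \<open>1 + q = - q^2\<close>.\<close>

lemma K_y1_power:
  "\<theta> (y G1 ^ 0) = 1" "K (Y 0 0 1) (y G1 ^ 0) = 0" "K (Y 0 0 2) (y G1 ^ 0) = 0"
  "\<theta> (y G1 ^ 1) = x G1" "K (Y 0 0 1) (y G1 ^ 1) = 0" "K (Y 0 0 2) (y G1 ^ 1) = sB l1 1"
  "\<theta> (y G1 ^ 2) = x G1 ^ 2" "K (Y 0 0 1) (y G1 ^ 2) = sB l1 1"
  "K (Y 0 0 2) (y G1 ^ 2) = sB (- (q\<^sup>2 * l1)) (x G1)"
proof -
  note step = K_generator[OF action_group_like_Y, of _ _ _ G1]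
  show 0: "\<theta> (y G1 ^ 0) = 1" "K (Y 0 0 1) (y G1 ^ 0) = 0" "K (Y 0 0 2) (y G1 ^ 0) = 0"
    by (simp_all add: theta_eq_K K_1 eps0_Y scale_simps_B del: One_nat_def)
  have Y1: "Y 0 0 0 * y G1 = Y 0 0 1" "Y 0 0 1 * y G1 = Y 0 0 2" "Y 0 0 2 * y G1 = sE l1 (Y 0 0 0)"
    by (simp_all add: Y_mult numeral_2_eq_2)
  note lin = linearD[OF K_linear_left]
  show 1: "\<theta> (y G1 ^ 1) = x G1" "K (Y 0 0 1) (y G1 ^ 1) = 0" "K (Y 0 0 2) (y G1 ^ 1) = sB l1 1"
    using step[of 0 0 0 1] step[of 0 0 1 1] step[of 0 0 2 1] 0
    by (simp_all add: theta_eq_K Y1 scale_simps_B lin del: One_nat_def)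
  show "\<theta> (y G1 ^ 2) = x G1 ^ 2" "K (Y 0 0 1) (y G1 ^ 2) = sB l1 1"
    using step[of 0 0 0 "y G1"] step[of 0 0 1 "y G1"] 1
    by (simp_all add: theta_eq_K Y1 scale_simps_B lin power2_eq_square del: One_nat_def)
  show "K (Y 0 0 2) (y G1 ^ 2) = sB (- (q\<^sup>2 * l1)) (x G1)"
    using step[of 0 0 2 "y G1"] 1
    by (simp add: theta_eq_K Y1 scale_simps_B lin power2_eq_square[of "y G1"] q_facts(2) algebra_simps
        del: One_nat_def)
      (simp add: q_square scale_simps_B algebra_simps)
qed

text \<open>This is \<open>K_y12\<close> with \<open>d = 0\<close>: the term that absorbs
  \<open>y12\<close> vanishes by \<open>K_Y_y1_power\<close>, and
  \<open>(1 - q^2) q^2 = q^2 - q\<close>.\<close>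

lemma theta_y12:
  "\<theta> (y12 * y G1 ^ c) = x12 * \<theta> (y G1 ^ c) + sB (q\<^sup>2 - q) (x G2 * K (Y 0 0 1) (y G1 ^ c))"
proof -
  have "(1 - q\<^sup>2) * (q * q) = q\<^sup>2 - q" by (simp add: q_square power2_eq_square algebra_simps)
  then show ?thesis
    by (simp add: theta_eq_K K_y12[OF action_group_like_Y] Y_mult K_Y_y1_power scale_simps_B)
qed

lemma theta_y12_y12:
  "\<theta> (y12 ^ 2 * y G1 ^ c) = x12 ^ 2 * \<theta> (y G1 ^ c) - sB (q\<^sup>2 - q) (x G2 * (x12 * K (Y 0 0 1) (y G1 ^ c)))
    + sB ((q\<^sup>2 - q) * l112) (x G2 * \<theta> (y G1 ^ c)) - sB (3 * q\<^sup>2) (x G2 ^ 2 * K (Y 0 0 2) (y G1 ^ c))"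
proof -
  let ?f = "y G1 ^ c"
  note lin = linearD[OF K_linear_left]
  have c: "(1 - q\<^sup>2) * (q * q) = q\<^sup>2 - q" "(1 - q * q) * q = q - 1" "q * (q * (q * q)) = q" "q ^ 4 = q"
    by (simp_all add: q_square power2_eq_square power_numeral_reduce algebra_simps)
  have "x12 * x G2 * z = sB (q\<^sup>2) (x G2 * x12) * z" for z by (simp only: relations_B(2))
  then have r: "x12 * (x G2 * z) = sB (q\<^sup>2) (x G2 * (x12 * z))" for z
    by (simp add: mult.assoc k_algebraD(2)[OF algebras(2)])
  \<comment> \<open>All three terms of \<open>K_y12\<close> keep a \<open>y12\<close> in the left
    factor and are evaluated at a power of \<open>y G1\<close>.\<close>
  have 1: "K (Y 0 1 0) (y12 * ?f) = 0"
    using Y_mult(1)[of 1 0 0] Y_mult(2)[of 1 0]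
    by (simp add: K_y12[OF action_group_like_Y] K_Y_y1_power scale_simps_B numeral_2_eq_2)
  \<comment> \<open>The parameter \<open>l112\<close> enters here, as the scalar part of
    \<open>y G1 * y12\<close>. The other coefficients are \<open>q^4 = q\<close> and
    \<open>(1 - q^2) q^4 = q - 1\<close>.\<close>
  have 2: "K (Y 0 0 1) (y12 * ?f) =
    sB l112 (\<theta> ?f) + sB q (x12 * K (Y 0 0 1) ?f) + sB (q - 1) (x G2 * K (Y 0 0 2) ?f)"
    using Y_mult(1)[of 0 0 1] Y_mult(3)[of 0 0] K_Y_y1_power[of 0 1 1 c]
    by (simp add: K_y12[OF action_group_like_Y] lin c scale_simps_B theta_eq_K numeral_2_eq_2)
  have "\<theta> (y12 * (y12 * ?f)) = x12 * \<theta> (y12 * ?f) + sB (q\<^sup>2 - q) (x G2 * K (Y 0 0 1) (y12 * ?f))"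
    using 1 by (simp add: theta_eq_K K_y12[OF action_group_like_Y] Y_mult c)
      (simp add: scale_simps_B)
  also have "\<dots> = x12 ^ 2 * \<theta> ?f + (sB ((q\<^sup>2 - q) * q\<^sup>2) (x G2 * (x12 * K (Y 0 0 1) ?f))
    + sB ((q\<^sup>2 - q) * q) (x G2 * (x12 * K (Y 0 0 1) ?f)))
    + sB ((q\<^sup>2 - q) * l112) (x G2 * \<theta> ?f) + sB ((q\<^sup>2 - q) * (q - 1)) (x G2 ^ 2 * K (Y 0 0 2) ?f)"
    unfolding theta_y12 2
    by (simp add: distrib_left r power2_eq_square[of x12] power2_eq_square[of "x G2"] mult.assoc
        k_algebraD(2,3)[OF algebras(2)] scale_laws(1,3)[OF spaces(2)] add_ac del: One_nat_def)
  \<comment> \<open>The weight \<open>q^2\<close> comes from moving \<open>x12\<close> past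
    \<open>x G2\<close>, the weight \<open>q\<close> from fact \<open>2\<close>; together they give
    \<open>- 1\<close>.\<close>
  also have "sB ((q\<^sup>2 - q) * q\<^sup>2) (x G2 * (x12 * K (Y 0 0 1) ?f)) + sB ((q\<^sup>2 - q) * q) (x G2 * (x12 * K (Y 0 0 1) ?f))
    = - sB (q\<^sup>2 - q) (x G2 * (x12 * K (Y 0 0 1) ?f))"
  proof -
    have "(q\<^sup>2 - q) * q\<^sup>2 + (q\<^sup>2 - q) * q = - (q\<^sup>2 - q)"
      by (simp add: q_square power2_eq_square algebra_simps)
    then show ?thesis by (metis scale_laws(2,8)[OF spaces(2)])
  qed
  \<comment> \<open>Source of the coefficient 3: the product is \<open>1 + q - 2 q^2\<close>, and
    \<open>1 + q = - q^2\<close>.\<close>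
  also have "(q\<^sup>2 - q) * (q - 1) = - (3 * q\<^sup>2)"
    by (simp add: q_square power2_eq_square algebra_simps)
  finally show ?thesis
    by (simp add: power2_eq_square[of y12] mult.assoc scale_simps_B)
qed

text \<open>The first index of a correction may exceed 2; such a monomial is zero because
  \<open>x G2 ^ 3 = 0\<close>, so one formula serves every \<open>a\<close>. The coefficient
  \<open>3 q\<close> in the last case is \<open>(- 3 q^2)(- q^2)\<close>, from
  \<open>theta_y12_y12\<close> and the last value in \<open>K_y1_power\<close>.\<close>

lemma theta_Y:
  assumes "a \<le> 2"
  shows "c \<le> 2 \<Longrightarrow> \<theta> (Y a 0 c) = X a 0 c"
    and "\<theta> (Y a 1 0) = X a 1 0"
    and "\<theta> (Y a 1 1) = X a 1 1"
    and "\<theta> (Y a 1 2) = X a 1 2 + sB ((q\<^sup>2 - q) * l1) (X (Suc a) 0 0)"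
    and "\<theta> (Y a 2 0) = X a 2 0 + sB ((q\<^sup>2 - q) * l112) (X (Suc a) 0 0)"
    and "\<theta> (Y a 2 1) = X a 2 1 + sB ((q\<^sup>2 - q) * l112) (X (Suc a) 0 1)
      - sB (3 * q\<^sup>2 * l1) (X (Suc (Suc a)) 0 0)"
    and "\<theta> (Y a 2 2) = X a 2 2 + sB ((q\<^sup>2 - q) * l112) (X (Suc a) 0 2)
      - sB ((q\<^sup>2 - q) * l1) (X (Suc a) 1 0) + sB (3 * q * l1) (X (Suc (Suc a)) 0 1)"
proof -
  have Y: "\<theta> (Y a b c) = x G2 ^ a * \<theta> (y12 ^ b * y G1 ^ c)" for b c
    using theta_y2_power[OF assms] by (simp add: pbw_def mult.assoc)
  have shift: "x G2 ^ a * (x G2 * z) = x G2 ^ Suc a * z" "x G2 ^ a * (x G2 ^ 2 * z) = x G2 ^ Suc (Suc a) * z"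
    "x G2 ^ a * x G2 = x G2 ^ Suc a" "x G2 ^ a * x G2 ^ 2 = x G2 ^ Suc (Suc a)" for z
    by (simp_all add: power_Suc2 power2_eq_square mult.assoc del: power_Suc)
  note simps = pbw_def scale_simps_B distrib_left right_diff_distrib mult.assoc shift
  show "\<theta> (Y a 0 c) = X a 0 c" if "c \<le> 2"
    using that K_y1_power(1,4,7) Y[of 0 c] by (auto simp: pbw_def le_2_cases)
  show "\<theta> (Y a 1 0) = X a 1 0"
    unfolding Y using theta_y12[of 0, unfolded K_y1_power] by (simp add: simps del: power_Suc)
  show "\<theta> (Y a 1 1) = X a 1 1"
    unfolding Y using theta_y12[of 1, unfolded K_y1_power] by (simp add: simps del: power_Suc)
  show "\<theta> (Y a 1 2) = X a 1 2 + sB ((q\<^sup>2 - q) * l1) (X (Suc a) 0 0)"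
    unfolding Y using theta_y12[of 2, unfolded K_y1_power] by (simp add: simps del: power_Suc)
  show "\<theta> (Y a 2 0) = X a 2 0 + sB ((q\<^sup>2 - q) * l112) (X (Suc a) 0 0)"
    unfolding Y using theta_y12_y12[of 0, unfolded K_y1_power] by (simp add: simps del: power_Suc)
  show "\<theta> (Y a 2 1) = X a 2 1 + sB ((q\<^sup>2 - q) * l112) (X (Suc a) 0 1)
      - sB (3 * q\<^sup>2 * l1) (X (Suc (Suc a)) 0 0)"
    unfolding Y using theta_y12_y12[of 1, unfolded K_y1_power] by (simp add: simps del: power_Suc)
  have "q ^ 4 = q" using q(1) by (simp add: power_numeral_reduce mult.assoc)
  then show "\<theta> (Y a 2 2) = X a 2 2 + sB ((q\<^sup>2 - q) * l112) (X (Suc a) 0 2)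
      - sB ((q\<^sup>2 - q) * l1) (X (Suc a) 1 0) + sB (3 * q * l1) (X (Suc (Suc a)) 0 1)"
    unfolding Y using theta_y12_y12[of 2, unfolded K_y1_power] by (simp add: simps del: power_Suc)
qed

subsection \<open>The section\<close>

lemma X_eq_0: "3 \<le> a \<Longrightarrow> X a b c = 0"
  using relations_B(1) le_Suc_ex[of 3 a] by (auto simp: pbw_def power_add)

lemma theta_bilinear: "bilinear_map sE sB sB (\<lambda>e0 b. sB (\<epsilon>0 e0) b)"
  using K_bilinear[of 1] by simp

lemma theta_word: "\<theta> (word_E w) = word_comult_sum sB q (\<lambda>u v. sB (\<epsilon>0 (word_E u)) (word_B v)) w"
  unfolding \<theta>_def by (rule coaction_E_word[OF theta_bilinear])

lemma coaction_linear: "tensor_linear sE sE sB \<rho>"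
  using E(5) by (simp add: braided_algebra_map_def)

lemma comult_linear: "tensor_linear sB sB sB \<Delta>B" "tensor_linear tscale tscale tscale \<Delta>T"
  using B(6) TV(4) by (simp_all add: braided_algebra_map_def)

text \<open>The identity \<open>(\<theta> \<otimes> id) \<rho> = \<Delta> \<theta>\<close>, paired
  with a functional on the right leg. On words both sides split into three factors with
  \<open>\<epsilon>0\<close> applied to the first and \<open>\<xi>\<close> to the third, so
  coassociativity suffices.\<close>

lemma theta_comodule_map:
  assumes \<xi>: "Vector_Spaces.linear sB (*) \<xi>"
  shows "tensor_lift (\<lambda>e0 b. sB (\<xi> b) (\<theta> e0)) (\<rho> e) = tensor_lift (\<lambda>b1 b2. sB (\<xi> b2) b1) (\<Delta>B (\<theta> e))"
proof -
  have id: "Vector_Spaces.linear sB sB (\<lambda>b. b)" by (simp add: linearI spaces)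
  have bil: "bilinear_map sE sB sB (\<lambda>e0 b. sB (\<xi> b) (\<theta> e0))" "bilinear_map sB sB sB (\<lambda>b1 b2. sB (\<xi> b2) b1)"
    using bilinear_map_compose[OF theta_linear \<xi> bilinear_map_scale(2)[OF spaces(2)]]
      bilinear_map_compose[OF id \<xi> bilinear_map_scale(2)[OF spaces(2)]] by auto
  define D where "D b = tensor_lift (\<lambda>b1 b2. sB (\<xi> b2) b1) (\<Delta>B b)" for b
  have D: "Vector_Spaces.linear sB sB D"
    unfolding D_def by (rule tensor_lift_linear[OF comult_linear(1) bil(2) spaces(2)])
  have sc: "Vector_Spaces.linear sB sB (sB c)" for c
    by (auto intro!: linearI simp: spaces scale_simps_B mult.commute)
  have "(\<lambda>e. tensor_lift (\<lambda>e0 b. sB (\<xi> b) (\<theta> e0)) (\<rho> e)) = (\<lambda>e. D (\<theta> e))"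
  proof (rule linear_eq_on_words_E[OF tensor_lift_linear[OF coaction_linear bil(1) spaces(3)]
        linear_comp[OF theta_linear D]])
    fix w
    have "tensor_lift (\<lambda>e0 b. sB (\<xi> b) (\<theta> e0)) (\<rho> (word_E w)) =
      word_comult_sum sB q (\<lambda>u v. word_comult_sum sB q
        (\<lambda>u1 u2. sB (\<xi> (word_B v) * \<epsilon>0 (word_E u1)) (word_B u2)) u) w"
      by (simp add: coaction_E_word[OF bil(1)] theta_word word_comult_sum_linear_image[OF sc] scale_simps_B)
    also have "\<dots> = word_comult_sum sB q (\<lambda>u v. word_comult_sum sB q
        (\<lambda>v1 v2. sB (\<xi> (word_B v2) * \<epsilon>0 (word_E u)) (word_B v1)) v) w"
      by (rule word_comult_sum_coassoc[OF spaces(2)])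
    also have "\<dots> = D (\<theta> (word_E w))"
      by (simp add: theta_word word_comult_sum_linear_image[OF D] linearD[OF D])
        (simp add: D_def comult_B_word[OF bil(2)] word_comult_sum_linear_image[OF sc] scale_simps_B mult.commute)
    finally show "tensor_lift (\<lambda>e0 b. sB (\<xi> b) (\<theta> e0)) (\<rho> (word_E w)) = D (\<theta> (word_E w))" .
  qed
  then show ?thesis by (simp add: D_def fun_eq_iff)
qed

lemma epsB_theta: "\<epsilon>B (\<theta> e) = \<epsilon>0 e"
proof -
  have "(\<lambda>e. \<epsilon>B (\<theta> e)) = \<epsilon>0"
  proof (rule linear_eq_on_words_E[OF linear_comp[OF theta_linear epsB_mult(1)] eps0(1)])
    fix w
    have "\<epsilon>B (\<theta> (word_E w)) = word_comult_sum (*) q (\<lambda>u v. if v = [] then \<epsilon>0 (word_E u) else 0) w"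
      unfolding theta_word word_comult_sum_linear_image[OF epsB_mult(1)]
      by (rule word_comult_sum_cong) (simp add: linearD[OF epsB_mult(1)] epsB_word)
    then show "\<epsilon>B (\<theta> (word_E w)) = \<epsilon>0 (word_E w)"
      by (simp add: word_comult_sum_counit[OF vector_space_field])
  qed
  then show ?thesis by (rule fun_cong)
qed

section \<open>The inverse of the comodule map\<close>

definition \<gamma> :: "'b \<Rightarrow> 'e" where
  "\<gamma> b = \<l> b + \<l> b - \<l> (\<theta> (\<l> b))"

lemma gamma_linear: "Vector_Spaces.linear sB sE \<gamma>"
  unfolding \<gamma>_def
  by (rule linearI)
    (simp_all add: spaces linearD[OF ell(1)] linearD[OF theta_linear] scale_simps_E algebra_simps)

lemma eps0_gamma: "\<epsilon>0 (\<gamma> b) = \<epsilon>B b"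
proof -
  have "\<epsilon>0 (\<l> b) = \<epsilon>B b" for b using eps0(2) by (metis comp_apply)
  then show ?thesis by (simp add: \<gamma>_def linearD[OF eps0(1)] epsB_theta)
qed

text \<open>\<open>N\<close> vanishes on all monomials that occur as corrections. The exponent
  \<open>a\<close> is unrestricted so that corrections with \<open>a > 2\<close>, which are zero,
  need no separate treatment.\<close>

lemma theta_ell:
  shows "c \<le> 2 \<Longrightarrow> \<theta> (\<l> (X a 0 c)) = X a 0 c" and "\<theta> (\<l> (X a 1 0)) = X a 1 0"
proof -
  show "\<theta> (\<l> (X a 0 c)) = X a 0 c" if "c \<le> 2"
    using that ell(3) theta_Y(1)
    by (cases "a \<le> 2") (simp_all add: X_eq_0 linearD[OF ell(1)] linearD[OF theta_linear])
  show "\<theta> (\<l> (X a 1 0)) = X a 1 0"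
    using ell(3) theta_Y(2)
    by (cases "a \<le> 2") (simp_all add: X_eq_0 linearD[OF ell(1)] linearD[OF theta_linear])
qed

lemma theta_gamma: "\<theta> (\<gamma> b) = b"
proof -
  have "(\<lambda>b. \<theta> (\<gamma> b)) = (\<lambda>b. b)"
  proof (rule linear_eq_on_pbw[OF linear_comp[OF gamma_linear theta_linear]])
    show "Vector_Spaces.linear sB sB (\<lambda>b. b)" by (simp add: linearI spaces)
    fix a b c :: nat
    assume a: "a \<le> 2" and "b \<le> 2" and c: "c \<le> 2"
    note lin = linearD[OF theta_linear] linearD[OF ell(1)]
    have Y: "\<theta> (\<l> (X a b c)) = \<theta> (Y a b c)" if "b \<le> 2" "c \<le> 2" for b c
      using a ell(3) that by simp
    from \<open>b \<le> 2\<close> c consider "b = 0" | "b = 1" "c = 0" | "b = 1" "c = 1" | "b = 1" "c = 2"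
      | "b = 2" "c = 0" | "b = 2" "c = 1" | "b = 2" "c = 2"
      by (auto simp: le_2_cases)
    then show "\<theta> (\<gamma> (X a b c)) = X a b c"
      by cases (simp_all add: \<gamma>_def lin Y theta_Y[OF a] theta_ell c del: One_nat_def)
  qed
  then show ?thesis by (rule fun_cong)
qed

text \<open>Injectivity of \<open>\<theta>\<close> without a dimension count: if
  \<open>\<theta> (\<l> b) = 0\<close>, then \<open>\<gamma> b\<close> is twice
  \<open>\<l> b\<close>, so applying \<open>\<theta>\<close> to it gives both \<open>b\<close> and
  0.\<close>

lemma gamma_theta: "\<gamma> (\<theta> e) = e"
proof -
  have "e = e'" if "\<theta> e = \<theta> e'" for e e'
  proof -
    obtain b where b: "e - e' = \<l> b" using bij_is_surj[OF ell(2)] by auto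
    have "\<theta> (\<l> b) = 0" by (simp flip: b add: linearD[OF theta_linear] that)
    then have "b = 0"
      using theta_gamma[of b] by (simp add: \<gamma>_def linearD[OF theta_linear] linearD[OF ell(1)])
    then show ?thesis using b by (simp add: linearD[OF ell(1)])
  qed
  then show ?thesis using theta_gamma by blast
qed

text \<open>The inverse of a comodule map is a comodule map: insert
  \<open>\<gamma> \<circ> \<theta>\<close> in the left leg and use the property of
  \<open>\<theta>\<close>. Pairing with functionals on the right leg determines the tensor because
  the PBW monomials are a finite spanning set.\<close>

lemma gamma_comodule_map: "tensor_eq sE sB (\<rho> (\<gamma> b)) (tensor_map \<gamma> id (\<Delta>B b))"
proof (rule tensor_eqI[OF spaces(3,2) finite_pbw pbw_spans])
  fix \<xi> :: "'b \<Rightarrow> 'k" assume \<xi>: "Vector_Spaces.linear sB (*) \<xi>"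
  have "tensor_lift (\<lambda>e0 b. sE (\<xi> b) e0) (\<rho> (\<gamma> b)) = \<gamma> (tensor_lift (\<lambda>e0 b. sB (\<xi> b) (\<theta> e0)) (\<rho> (\<gamma> b)))"
    by (simp add: tensor_lift_linear_image[OF gamma_linear] linearD[OF gamma_linear] gamma_theta)
  also have "\<dots> = tensor_lift (\<lambda>b1 b2. sE (\<xi> b2) (\<gamma> b1)) (\<Delta>B b)"
    by (simp add: theta_comodule_map[OF \<xi>] theta_gamma tensor_lift_linear_image[OF gamma_linear]
        linearD[OF gamma_linear])
  finally show "tensor_lift (\<lambda>e0 b. sE (\<xi> b) e0) (\<rho> (\<gamma> b)) =
      tensor_lift (\<lambda>e0 b. sE (\<xi> b) e0) (tensor_map \<gamma> id (\<Delta>B b))"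
    by (simp add: tensor_lift_tensor_map)
qed

lemma gamma_one: "\<gamma> 1 = 1"
proof -
  have "\<l> (X 0 0 0) = Y 0 0 0" "\<theta> (Y 0 0 0) = X 0 0 0"
    using ell(3) theta_Y(1)[of 0 0] by auto
  then show ?thesis by (simp add: \<gamma>_def pbw_def)
qed

section \<open>Agreement with the formula through the reduced coproduct\<close>

lemma eps0_tau2: "\<epsilon>0 (\<pi>E (\<tau>2 t)) = \<epsilon>0 (\<pi>E t) - \<epsilon>B (\<pi>B t)"
proof -
  interpret T: vector_space "tscale :: 'k \<Rightarrow> 'k tensor_algebra \<Rightarrow> _" by (rule spaces)
  note lin = linearD[OF projections_linear(1)] linearD[OF projections_linear(2)]
    linearD[OF eps0(1)] linearD[OF epsB_mult(1)]
  \<comment> \<open>On the span of the PBW monomials the two functionals coincide. It contains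
    \<open>t - \<tau>2 t\<close>, and the remaining part \<open>\<tau>2 t\<close> is killed by
    \<open>\<pi>B\<close>.\<close>
  have agree: "\<epsilon>0 (\<pi>E s) = \<epsilon>B (\<pi>B s)"
    if "s \<in> T.span {pbw tscale q tgen n2 n12 n1 | n2 n12 n1. n2 \<le> 2 \<and> n12 \<le> 2 \<and> n1 \<le> 2}" for s
    using that
  proof (induction rule: T.span_induct_alt)
    case (step c p s)
    then show ?case by (auto simp: lin projections_pbw eps0_Y epsB_X)
  qed (simp add: lin)
  have "\<tau>2 (t - \<tau>2 t) = 0" by (simp add: linearD[OF tau2_facts(1)] tau2_facts(3))
  then have "\<epsilon>0 (\<pi>E (t - \<tau>2 t)) = \<epsilon>B (\<pi>B (t - \<tau>2 t))" using agree tau2_facts(4) by blast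
  then show ?thesis by (simp add: lin tau2_facts(2) algebra_simps)
qed

text \<open>The terms \<open>a \<otimes> 1\<close> and \<open>1 \<otimes> a\<close> removed from the
  coproduct contribute nothing, since \<open>\<tau>2\<close> kills both 1 and the PBW monomial, and
  the degree-zero correction drops out by \<open>F 1 = 0\<close>. What remains is \<open>F\<close>,
  the full coproduct paired with \<open>\<beta>\<close>, whose value at the monomial is
  \<open>\<l> \<theta> \<l> - \<l>\<close> of its image.\<close>

lemma gamma_formula:
  assumes n: "n2 \<le> 2" "n12 \<le> 2" "n1 \<le> 2"
  shows "\<gamma> (X n2 n12 n1) = Y n2 n12 n1 -
    tensor_lift (\<lambda>c e. sE c e) (tensor_map \<epsilon>0 \<l> (tensor_map (\<pi>E \<circ> \<tau>2) \<pi>B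
      (reduced_comult \<Delta>T (pbw tscale q tgen n2 n12 n1))))"
proof -
  interpret T: vector_space "tscale :: 'k \<Rightarrow> 'k tensor_algebra \<Rightarrow> _" by (rule spaces)
  define \<beta> where "\<beta> a b = sE (\<epsilon>0 (\<pi>E (\<tau>2 a))) (\<l> (\<pi>B b))" for a b
  have \<beta>: "bilinear_map tscale tscale sE \<beta>"
    unfolding \<beta>_def
    by (rule bilinear_map_compose[OF linear_comp[OF linear_comp[OF tau2_facts(1) projections_linear(2)] eps0(1)]
          linear_comp[OF projections_linear(1) ell(1)] bilinear_map_scale(1)[OF spaces(3)]])
  define F where "F t = tensor_lift \<beta> (\<Delta>T t)" for t
  have F: "Vector_Spaces.linear tscale sE F"
    unfolding F_def by (rule tensor_lift_linear[OF comult_linear(2) \<beta> spaces(1)])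
  have F_eq: "F t = \<l> (\<theta> (\<pi>E t)) - \<l> (\<pi>B t)" for t
  proof (rule linear_eq_on_words[OF F])
    have 1: "Vector_Spaces.linear tscale sE (\<lambda>t. \<l> (\<theta> (\<pi>E t)))" "Vector_Spaces.linear tscale sE (\<lambda>t. \<l> (\<pi>B t))"
      using linear_comp[OF projections_linear(2) linear_comp[OF theta_linear ell(1)]]
        linear_comp[OF projections_linear(1) ell(1)] by auto
    show "Vector_Spaces.linear tscale sE (\<lambda>t. \<l> (\<theta> (\<pi>E t)) - \<l> (\<pi>B t))"
      by (rule linearI) (simp_all add: spaces linearD[OF 1(1)] linearD[OF 1(2)] scale_simps_E algebra_simps)
    fix w
    \<comment> \<open>By \<open>eps0_tau2\<close> the left leg is evaluated by a difference of two
      functionals; the one from the Nichols algebra survives only at the empty word.\<close>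
    have "F (word_T w) = word_comult_sum sE q (\<lambda>u v. \<l> (sB (\<epsilon>0 (word_E u)) (word_B v)) +
        (if u = [] then - \<l> (word_B v) else 0)) w"
      unfolding F_def comult_T_word[OF \<beta>]
      by (rule word_comult_sum_cong)
        (simp add: \<beta>_def eps0_tau2 projections_word epsB_word linearD[OF ell(1)] scale_simps_E)
    then show "F (word_T w) = \<l> (\<theta> (\<pi>E (word_T w))) - \<l> (\<pi>B (word_T w))"
      by (simp add: word_comult_sum_add[OF spaces(3)] word_comult_sum_counit[OF spaces(3)] projections_word
          theta_word word_comult_sum_linear_image[OF ell(1)])
  qed
  let ?a = "pbw tscale q tgen n2 n12 n1"
  have W: "\<tau>2 (pbw tscale q tgen n2 n12 n1) = 0" if "n2 \<le> 2" "n12 \<le> 2" "n1 \<le> 2" for n2 n12 n1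
    unfolding tau2_facts(4) using that by (intro T.span_base) blast
  have "\<tau>2 1 = 0" using W[of 0 0 0] by (simp add: pbw_def)
  have "F 1 = 0"
    by (simp add: F_eq projections_mult theta_eq_K K_1 pbw_def)
      (use eps0_Y[of 0 0 0] in \<open>simp add: pbw_def scale_simps_B\<close>)
  define a' where "a' = ?a - tscale (Poly_Mapping.lookup ?a 0) 1"
  have "\<tau>2 a' = 0" by (simp add: a'_def linearD[OF tau2_facts(1)] W[OF n] \<open>\<tau>2 1 = 0\<close>)
  have "tensor_lift (\<lambda>c e. sE c e) (tensor_map \<epsilon>0 \<l> (tensor_map (\<pi>E \<circ> \<tau>2) \<pi>B (reduced_comult \<Delta>T ?a)))
    = tensor_lift \<beta> (reduced_comult \<Delta>T ?a)"
    by (simp add: tensor_lift_tensor_map \<beta>_def[abs_def])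
  also have "\<dots> = F a' + (\<beta> (- a') 1 + \<beta> 1 (- a'))"
    by (simp add: reduced_comult_def Let_def a'_def F_def)
  also have "\<dots> = F a'"
    unfolding \<beta>_def
    by (simp add: linearD[OF tau2_facts(1)] \<open>\<tau>2 a' = 0\<close> \<open>\<tau>2 1 = 0\<close> linearD[OF projections_linear(2)]
        linearD[OF eps0(1)] scale_simps_E)
  also have "\<dots> = F ?a" by (simp add: a'_def linearD[OF F] \<open>F 1 = 0\<close> scale_simps_E)
  finally show ?thesis
    using ell(3) n by (simp add: F_eq projections_pbw \<gamma>_def)
qed

subsection \<open>Convolution invertibility\<close>

definition conv_BE :: "('b \<Rightarrow> 'e) \<Rightarrow> ('b \<Rightarrow> 'e) \<Rightarrow> 'b \<Rightarrow> 'e" where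
  "conv_BE f h b = tensor_lift (\<lambda>b1 b2. f b1 * h b2) (\<Delta>B b)"

definition unit_BE :: "'b \<Rightarrow> 'e" where
  "unit_BE b = sE (\<epsilon>B b) 1"

abbreviation (input) "lin \<equiv> Vector_Spaces.linear sB sE"

lemma conv_BE_bilinear:
  assumes "lin f" "lin h"
  shows "bilinear_map sB sB sE (\<lambda>b1 b2. f b1 * h b2)"
  by (rule bilinear_mapI; rule linearI)
    (simp_all add: spaces linearD[OF assms(1)] linearD[OF assms(2)] scale_simps_E algebra_simps)

lemma conv_BE_linear: "lin f \<Longrightarrow> lin h \<Longrightarrow> lin (conv_BE f h)"
  unfolding conv_BE_def by (rule tensor_lift_linear[OF comult_linear(1) conv_BE_bilinear spaces(2)])

lemma conv_BE_word:
  assumes "lin f" "lin h"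
  shows "conv_BE f h (word_B w) = word_comult_sum sE q (\<lambda>u v. f (word_B u) * h (word_B v)) w"
  unfolding conv_BE_def by (rule comult_B_word[OF conv_BE_bilinear[OF assms]])

lemma unit_BE_linear: "lin unit_BE"
  unfolding unit_BE_def by (rule linearI) (simp_all add: spaces linearD[OF epsB_mult(1)] scale_simps_E)

lemma conv_BE_unit:
  assumes "lin f"
  shows "conv_BE unit_BE f = f" "conv_BE f unit_BE = f"
proof -
  show "conv_BE unit_BE f = f"
  proof (rule linear_eq_on_words_B[OF conv_BE_linear[OF unit_BE_linear assms] assms])
    fix w
    have "conv_BE unit_BE f (word_B w) = word_comult_sum sE q (\<lambda>u v. if u = [] then f (word_B v) else 0) w"
      unfolding conv_BE_word[OF unit_BE_linear assms]
      by (rule word_comult_sum_cong) (simp add: unit_BE_def epsB_word scale_simps_E)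
    then show "conv_BE unit_BE f (word_B w) = f (word_B w)"
      by (simp add: word_comult_sum_counit[OF spaces(3)])
  qed
  show "conv_BE f unit_BE = f"
  proof (rule linear_eq_on_words_B[OF conv_BE_linear[OF assms unit_BE_linear] assms])
    fix w
    have "conv_BE f unit_BE (word_B w) = word_comult_sum sE q (\<lambda>u v. if v = [] then f (word_B u) else 0) w"
      unfolding conv_BE_word[OF assms unit_BE_linear]
      by (rule word_comult_sum_cong) (simp add: unit_BE_def epsB_word scale_simps_E)
    then show "conv_BE f unit_BE (word_B w) = f (word_B w)"
      by (simp add: word_comult_sum_counit[OF spaces(3)])
  qed
qed

lemma conv_BE_assoc:
  assumes "lin f" "lin h" "lin k"
  shows "conv_BE (conv_BE f h) k = conv_BE f (conv_BE h k)"
proof (rule linear_eq_on_words_B[where s = sE])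
  fix w
  show "conv_BE (conv_BE f h) k (word_B w) = conv_BE f (conv_BE h k) (word_B w)"
    using word_comult_sum_coassoc[OF spaces(3), of q "\<lambda>u1 u2 v. f (word_B u1) * h (word_B u2) * k (word_B v)" w]
    by (simp add: conv_BE_word conv_BE_linear assms
        word_comult_sum_linear_image[OF linear_mult(1)[OF algebras(3)]]
        word_comult_sum_linear_image[OF linear_mult(2)[OF algebras(3)]] mult.assoc)
qed (simp_all add: conv_BE_linear assms)

lemma conv_BE_add:
  "conv_BE (\<lambda>b. f b + f' b) h = (\<lambda>b. conv_BE f h b + conv_BE f' h b)"
  "conv_BE f (\<lambda>b. h b + h' b) = (\<lambda>b. conv_BE f h b + conv_BE f h' b)"
  by (simp_all add: conv_BE_def distrib_left distrib_right tensor_lift_add fun_eq_iff)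

lemma conv_BE_sum:
  fixes n :: nat
  shows "conv_BE f (\<lambda>b. \<Sum>i<n. h i b) = (\<lambda>b. \<Sum>i<n. conv_BE f (h i) b)" (is ?left)
  "conv_BE (\<lambda>b. \<Sum>i<n. h i b) f = (\<lambda>b. \<Sum>i<n. conv_BE (h i) f b)" (is ?right)
proof -
  have 0: "tensor_lift (\<lambda>a b. 0) u = (0::'e)" for u :: "('b \<times> 'b) list"
    by (induction u) simp_all
  show ?left
    by (induction n) (simp_all add: conv_BE_add, simp add: conv_BE_def 0)
  show ?right
    by (induction n) (simp_all add: conv_BE_add, simp add: conv_BE_def 0)
qed

text \<open>The words form a conilpotent coalgebra, so the geometric series in \<open>f - \<epsilon>\<close> terminates.\<close>

lemma convolution_invertible_if_unital:
  assumes f: "lin f" and "f 1 = 1"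
  shows "convolution_invertible sB sE \<Delta>B \<epsilon>B f"
proof -
  define \<nu> where "\<nu> b = unit_BE b - f b" for b
  have \<nu>: "lin \<nu>"
    unfolding \<nu>_def
    by (rule linearI) (simp_all add: spaces linearD[OF f] linearD[OF unit_BE_linear] scale_simps_E)
  define P where "P n = (conv_BE \<nu> ^^ n) unit_BE" for n
  have P_simps: "P 0 = unit_BE" "P (Suc n) = conv_BE \<nu> (P n)" for n by (simp_all add: P_def)
  have P: "lin (P n)" for n
    by (induction n) (simp_all add: P_simps unit_BE_linear conv_BE_linear \<nu>)
  \<comment> \<open>The powers are built by convolving on the left; this commutation makes the
    inverse two-sided.\<close>
  have P_right: "conv_BE (P n) \<nu> = P (Suc n)" for n
    by (induction n) (simp_all add: P_simps conv_BE_unit \<nu> conv_BE_assoc P)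
  \<comment> \<open>In each splitting of the word either \<open>u\<close> is empty and
    \<open>\<nu> 1 = 0\<close>, or \<open>v\<close> is strictly shorter than \<open>w\<close> and
    the induction hypothesis applies.\<close>
  have P_word: "P n (word_B w) = 0" if "length w < n" for n w
    using that
  proof (induction n arbitrary: w)
    case (Suc n)
    have \<nu>1: "\<nu> 1 = 0" by (simp add: \<nu>_def unit_BE_def epsB_mult scale_simps_E \<open>f 1 = 1\<close>)
    have "P (Suc n) (word_B w) = word_comult_sum sE q (\<lambda>u v. 0) w"
      unfolding P_simps conv_BE_word[OF \<nu> P]
    proof (rule word_comult_sum_cong)
      fix u v :: "gen list" assume "length u + length v = length w"
      with Suc show "\<nu> (word_B u) * P n (word_B v) = 0" by (cases u) (simp_all add: \<nu>1)
    qed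
    also have "\<dots> = 0"
      using word_comult_sum_counit(1)[OF spaces(3), of q "\<lambda>_. 0" w] by simp
    finally show ?case .
  qed simp
  have nilpotent: "\<exists>m. \<forall>n\<ge>m. P n (\<pi>B t) = 0" for t
  proof -
    interpret T: vector_space "tscale :: 'k \<Rightarrow> 'k tensor_algebra \<Rightarrow> _" by (rule spaces)
    have "t \<in> T.span (range (\<lambda>w. word_T w))" using span_words[OF spaces(1)] by simp
    then show ?thesis
    proof (induction rule: T.span_induct_alt)
      case base
      then show ?case by (simp add: linearD[OF projections_linear(1)] linearD[OF P])
    next
      case (step c s t)
      then obtain w m where "s = word_T w" "\<forall>n\<ge>m. P n (\<pi>B t) = 0" by auto
      then show ?case
        by (intro exI[of _ "max m (Suc (length w))"])
          (simp add: linearD[OF projections_linear(1)] linearD[OF P] projections_word P_word scale_simps_E)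
    qed
  qed
  have "\<exists>m. \<forall>n\<ge>m. P n b = 0" for b
  proof -
    obtain t where "b = \<pi>B t" using projections(3) by auto
    then show ?thesis using nilpotent by simp
  qed
  then obtain m where m: "\<And>b n. n \<ge> m b \<Longrightarrow> P n b = 0" by metis
  let ?S = "{X n2 n12 n1 | n2 n12 n1. n2 \<le> 2 \<and> n12 \<le> 2 \<and> n1 \<le> 2}"
  \<comment> \<open>The bound \<open>m b\<close> depends on the element; its maximum over the finite
    PBW spanning set gives one power that vanishes identically, so the inverse is a finite sum of
    linear maps.\<close>
  define N where "N = Max (m ` ?S)"
  have "P N = (\<lambda>b. 0)"
  proof (rule linear_eq_on_spanning[OF P _ pbw_spans])
    show "lin (\<lambda>b. 0)" by (rule linearI) (simp_all add: spaces scale_simps_E)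
    fix b assume "b \<in> ?S"
    then have "m b \<le> N" unfolding N_def using finite_pbw by (intro Max_ge) auto
    then show "P N b = 0" by (rule m)
  qed
  define f' where "f' b = (\<Sum>n<N. P n b)" for b
  have f': "lin f'"
  proof -
    have "lin (\<lambda>b. \<Sum>n<M. P n b)" for M
      by (induction M) (auto simp: Vector_Spaces.linear_iff spaces linearD[OF P] scale_simps_E)
    then show ?thesis by (simp add: f'_def[abs_def])
  qed
  have f_eq: "f = (\<lambda>b. unit_BE b + - \<nu> b)" by (simp add: \<nu>_def)
  have telescope: "(\<Sum>n<M. P n b) - (\<Sum>n<M. P (Suc n) b) = P 0 b - P M b" for M b
    by (induction M) (simp_all add: algebra_simps)
  have minus: "tensor_lift (\<lambda>b1 b2. - \<beta> b1 b2) u = - tensor_lift \<beta> u"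
    for \<beta> :: "'b \<Rightarrow> 'b \<Rightarrow> 'e" and u
    by (induction u) simp_all
  have neg: "conv_BE (\<lambda>b. - \<nu> b) h = (\<lambda>b. - conv_BE \<nu> h b)"
      "conv_BE h (\<lambda>b. - \<nu> b) = (\<lambda>b. - conv_BE h \<nu> b)" for h
    by (simp_all add: conv_BE_def fun_eq_iff minus)
  have geometric: "f' b - (\<Sum>n<N. P (Suc n) b) = unit_BE b" for b
    using telescope[of b N] by (simp add: f'_def \<open>P N = (\<lambda>b. 0)\<close> P_simps(1))
  have "conv_BE f f' b = f' b - conv_BE \<nu> f' b" "conv_BE f' f b = f' b - conv_BE f' \<nu> b" for b
    unfolding f_eq conv_BE_add conv_BE_unit[OF f'] neg by simp_all
  moreover have "conv_BE \<nu> f' b = (\<Sum>n<N. P (Suc n) b)" "conv_BE f' \<nu> b = (\<Sum>n<N. P (Suc n) b)" for b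
    unfolding f'_def[abs_def] conv_BE_sum by (simp_all only: P_right flip: P_simps(2))
  ultimately have "conv_BE f f' b = unit_BE b" "conv_BE f' f b = unit_BE b" for b
    by (simp_all only: geometric)
  then show ?thesis
    unfolding convolution_invertible_def conv_BE_def tensor_lift_def unit_BE_def
    by (intro exI[of _ f'] conjI f') simp_all
qed

subsection \<open>Equivariance and explicit values\<close>

text \<open>The character \<open>\<chi>\<^sub>1\<^sup>i \<chi>\<^sub>2\<^sup>j\<close> by which
  \<open>H\<close> acts on a word with \<open>i\<close> letters of index 1 and \<open>j\<close> of
  index 2. A fixed order of the factors is enough because the two characters commute.\<close>

definition monomial_char :: "nat \<Rightarrow> nat \<Rightarrow> 'h \<Rightarrow> 'k" where
  "monomial_char i j = (conv H (\<chi> G1) ^^ i) ((conv H (\<chi> G2) ^^ j) (counit H))"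

lemma char_linear: "Vector_Spaces.linear (scal H) (*) (\<chi> i)"
  using realization by (simp add: principal_yd_realization_def algebra_map_def)

lemma monomial_char_linear: "Vector_Spaces.linear (scal H) (*) (monomial_char i j)"
proof -
  have "Vector_Spaces.linear (scal H) (*) ((conv H (\<chi> G2) ^^ j) (counit H))"
    by (induction j) (simp_all add: linear_counit[OF H] linear_conv[OF H] char_linear)
  then show ?thesis
    unfolding monomial_char_def by (induction i) (simp_all add: linear_conv[OF H] char_linear)
qed

lemma conv_monomial_char:
  "conv H (\<chi> G1) (monomial_char i j) = monomial_char (Suc i) j"
  "conv H (\<chi> G2) (monomial_char i j) = monomial_char i (Suc j)"
proof -
  show 1: "conv H (\<chi> G1) (monomial_char i j) = monomial_char (Suc i) j" for i j
    by (simp add: monomial_char_def)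
  have swap: "conv H (\<chi> G2) (conv H (\<chi> G1) \<phi>) = conv H (\<chi> G1) (conv H (\<chi> G2) \<phi>)"
    if "Vector_Spaces.linear (scal H) (*) \<phi>" for \<phi>
    using conv_realization_commute[OF H realization q_facts(1), of G1 G2]
    by (simp add: char_linear that flip: conv_assoc[OF H])
  show "conv H (\<chi> G2) (monomial_char i j) = monomial_char i (Suc j)"
  proof (induction i)
    case 0
    show ?case by (simp add: monomial_char_def)
  next
    case (Suc i)
    have "conv H (\<chi> G2) (monomial_char (Suc i) j) = conv H (\<chi> G1) (conv H (\<chi> G2) (monomial_char i j))"
      by (simp only: swap[OF monomial_char_linear] flip: 1)
    then show ?case by (simp add: Suc 1)
  qed
qed

text \<open>Multiplying by the parameter encodes its vanishing condition: either it is zero, or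
  \<open>\<chi>\<^sub>1\<^sup>3\<close>, respectively
  \<open>\<chi>\<^sub>1\<^sup>2 \<chi>\<^sub>2\<close>, is trivial.\<close>

lemma monomial_char_periodic:
  "l1 * monomial_char (i + 3) j h = l1 * monomial_char i j h"
  "l112 * monomial_char (i + 2) (Suc j) h = l112 * monomial_char i j h"
proof -
  note lin = char_linear monomial_char_linear linear_counit[OF H] linear_conv[OF H]
  note assoc = conv_assoc[OF H] conv_counit[OF H]
  have "conv H (conv_power H (\<chi> G1) 3) (monomial_char i j) = monomial_char (i + 3) j"
    by (simp add: numeral_3_eq_3 assoc lin conv_monomial_char)
  moreover have "conv H (counit H) (monomial_char i j) = monomial_char i j"
    by (simp add: assoc lin)
  ultimately show "l1 * monomial_char (i + 3) j h = l1 * monomial_char i j h"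
    using lambda(1) by (cases "l1 = 0") auto
  have "conv H (conv H (conv_power H (\<chi> G1) 2) (\<chi> G2)) (monomial_char i j) = monomial_char (i + 2) (Suc j)"
    by (simp add: numeral_2_eq_2 assoc lin conv_monomial_char)
  with \<open>conv H (counit H) (monomial_char i j) = monomial_char i j\<close>
  show "l112 * monomial_char (i + 2) (Suc j) h = l112 * monomial_char i j h"
    using lambda(2) by (cases "l112 = 0") auto
qed

text \<open>The exponents count letters, \<open>y12\<close> contributing one of each kind. Both
  terms of the bracket have the same character since \<open>conv_monomial_char\<close> allows
  letters to be added in either order.\<close>

lemma action_pbw:
  assumes M: "module_algebra H s act" and A: "k_algebra s" and z: "\<And>i h. act h (z i) = s (\<chi> i h) (z i)"
  shows "act h (pbw s q z a b c) = s (monomial_char (b + c) (a + b) h) (pbw s q z a b c)"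
proof -
  have lin: "Vector_Spaces.linear s s (act h)" for h using M by (simp add: module_algebra_def)
  have gen: "act h (z G1 * r) = s (monomial_char (Suc i) j h) (z G1 * r)"
      "act h (z G2 * r) = s (monomial_char i (Suc j) h) (z G2 * r)"
    if "\<And>h. act h r = s (monomial_char i j h) r" for r i j h
    using module_algebra_eigen_mult[OF M A z that] by (simp_all add: conv_monomial_char)
  have 1: "act h (z G1 ^ c) = s (monomial_char c 0 h) (z G1 ^ c)" for h
  proof (induction c arbitrary: h)
    case 0
    show ?case using M by (simp add: module_algebra_def monomial_char_def)
  qed (simp add: gen)
  let ?z12 = "q_bracket s q (z G1) (z G2)"
  have 2: "act h (?z12 ^ b * z G1 ^ c) = s (monomial_char (b + c) b h) (?z12 ^ b * z G1 ^ c)" for h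
  proof (induction b arbitrary: h)
    case 0
    show ?case by (simp add: 1)
  next
    case (Suc b)
    let ?r = "?z12 ^ b * z G1 ^ c"
    have r: "?z12 ^ Suc b * z G1 ^ c = z G1 * (z G2 * ?r) - s q (z G2 * (z G1 * ?r))"
      by (simp add: q_bracket_def left_diff_distrib k_algebraD[OF A] mult.assoc)
    show ?case
      unfolding r
      by (simp add: linearD[OF lin] gen[OF gen(1)[OF Suc]] gen[OF gen(2)[OF Suc]]
          scale_laws[OF k_algebraD(1)[OF A]] mult.commute)
  qed
  have "act h (z G2 ^ a * (?z12 ^ b * z G1 ^ c)) =
      s (monomial_char (b + c) (a + b) h) (z G2 ^ a * (?z12 ^ b * z G1 ^ c))" for h
  proof (induction a arbitrary: h)
    case (Suc a)
    from gen(2)[OF this] show ?case by (simp add: mult.assoc)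
  qed (simp add: 2)
  then show ?thesis by (simp add: pbw_def mult.assoc)
qed

lemma action_X: "actB h (X a b c) = sB (monomial_char (b + c) (a + b) h) (X a b c)"
  by (rule action_pbw[OF modules(2) algebras(2)]) (use B(4) in simp)

lemma action_Y: "actE h (Y a b c) = sE (monomial_char (b + c) (a + b) h) (Y a b c)"
  by (rule action_pbw[OF E(3) algebras(3)]) (use E(4) in simp)

text \<open>A correction with coefficient \<open>l1\<close> has the character of its leading
  monomial up to \<open>\<chi>\<^sub>1\<^sup>3\<close>, one with \<open>l112\<close> up to
  \<open>\<chi>\<^sub>1\<^sup>2 \<chi>\<^sub>2\<close>; \<open>monomial_char_periodic\<close>
  removes the difference.\<close>

lemma theta_equivariant: "\<theta> (actE h e) = actB h (\<theta> e)"
proof -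
  have linE: "Vector_Spaces.linear sE sE (actE h)" and linB: "Vector_Spaces.linear sB sB (actB h)"
    using E(3) modules(2) by (simp_all add: module_algebra_def)
  have "(\<lambda>e. \<theta> (actE h e)) = (\<lambda>e. actB h (\<theta> e))"
  proof (rule linear_eq_on_pbw_E[OF linear_comp[OF linE theta_linear] linear_comp[OF theta_linear linB]])
    fix a b c :: nat
    assume a: "a \<le> 2" and "b \<le> 2" and c: "c \<le> 2"
    let ?m = "\<lambda>i j. monomial_char i j h"
    have l1: "?m i j * (t * l1) = t * l1 * ?m i' j'" if "i = i' + 3" "j = j'" for i j i' j' t
      using monomial_char_periodic(1)[of i' j' h] that by auto
    have l112: "?m i j * (t * l112) = t * l112 * ?m i' j'" if "i = i' + 2" "j = Suc j'" for i j i' j' t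
      using monomial_char_periodic(2)[of i' j' h] that by auto
    note simps = linearD(3,4,7)[OF linB] action_X scale_laws(1,3,9)[OF spaces(2)]
    from \<open>b \<le> 2\<close> c consider "b = 0" | "b = 1" "c = 0" | "b = 1" "c = 1" | "b = 1" "c = 2"
      | "b = 2" "c = 0" | "b = 2" "c = 1" | "b = 2" "c = 2"
      by (auto simp: le_2_cases)
    then have "actB h (\<theta> (Y a b c)) = sB (?m (b + c) (a + b)) (\<theta> (Y a b c))"
    proof cases
      case 1
      show ?thesis unfolding 1 theta_Y(1)[OF a c] by (rule action_X)
    next
      case 2
      show ?thesis unfolding 2 theta_Y(2)[OF a] by (rule action_X)
    next
      case 3
      show ?thesis unfolding 3 theta_Y(3)[OF a] by (rule action_X)
    next
      case 4
      have "?m (1 + 2) (a + 1) * (t * l1) = t * l1 * ?m (0 + 0) (Suc a + 0)" for t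
        by (rule l1) auto
      then show ?thesis unfolding 4 theta_Y(4)[OF a] by (simp only: simps)
    next
      case 5
      have "?m (2 + 0) (a + 2) * (t * l112) = t * l112 * ?m (0 + 0) (Suc a + 0)" for t
        by (rule l112) auto
      then show ?thesis unfolding 5 theta_Y(5)[OF a] by (simp only: simps)
    next
      case 6
      have "?m (2 + 1) (a + 2) * (t * l112) = t * l112 * ?m (0 + 1) (Suc a + 0)"
        "?m (2 + 1) (a + 2) * (t * l1) = t * l1 * ?m (0 + 0) (Suc (Suc a) + 0)" for t
        by (rule l112; auto) (rule l1; auto)
      then show ?thesis unfolding 6 theta_Y(6)[OF a] by (simp only: simps)
    next
      case 7
      have "?m (2 + 2) (a + 2) * (t * l112) = t * l112 * ?m (0 + 2) (Suc a + 0)"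
        "?m (2 + 2) (a + 2) * (t * l1) = t * l1 * ?m (1 + 0) (Suc a + 1)" for t
        by (rule l112; auto) (rule l1; auto)
      \<comment> \<open>The two \<open>l1\<close> corrections, one with an \<open>x12\<close> and
        one with separate \<open>x G2\<close> and \<open>x G1\<close>, contain the same
        letters.\<close>
      moreover have "?m (1 + 0) (Suc a + 1) = ?m (0 + 1) (Suc (Suc a) + 0)" by simp
      ultimately show ?thesis unfolding 7 theta_Y(7)[OF a] by (simp only: simps)
    qed
    then show "\<theta> (actE h (Y a b c)) = actB h (\<theta> (Y a b c))"
      by (simp add: action_Y linearD[OF theta_linear])
  qed
  then show ?thesis by (rule fun_cong)
qed

lemma gamma_equivariant: "\<gamma> (actB h b) = actE h (\<gamma> b)"
  by (metis gamma_theta theta_gamma theta_equivariant)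

theorem gamma_section: "is_section sB actB \<Delta>B \<epsilon>B sE actE \<rho> \<gamma>"
  unfolding is_section_def
proof (intro conjI allI)
  show "bij \<gamma>"
    by (rule bij_betw_byWitness[where f' = \<theta>]) (simp_all add: theta_gamma gamma_theta)
qed (simp_all add: gamma_linear gamma_equivariant gamma_comodule_map gamma_one
    convolution_invertible_if_unital)

section \<open>Values on the PBW basis\<close>

lemma gamma_X:
  assumes "a \<le> 2" "b \<le> 2" "c \<le> 2"
  shows "\<gamma> (X a b c) = Y a b c + Y a b c - \<l> (\<theta> (Y a b c))"
  using assms ell(3) by (simp add: \<gamma>_def)

lemma gamma_values:
  "\<gamma> (X 0 2 0) = Y 0 2 0 - sE ((q^2 - q) * l112) (Y 1 0 0)"
  "\<gamma> (X 0 2 1) = Y 0 2 1 + sE (3 * q^2 * l1) (Y 2 0 0) - sE ((q^2 - q) * l112) (Y 1 0 1)"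
  "\<gamma> (X 0 1 2) = Y 0 1 2 - sE ((q^2 - q) * l1) (Y 1 0 0)"
  "\<gamma> (X 1 2 0) = Y 1 2 0 - sE ((q^2 - q) * l112) (Y 2 0 0)"
  "\<gamma> (X 1 1 2) = Y 1 1 2 - sE ((q^2 - q) * l1) (Y 2 0 0)"
  "\<gamma> (X 1 2 1) = Y 1 2 1 - sE ((q^2 - q) * l112) (Y 2 0 1)"
  "\<gamma> (X 0 2 2) = Y 0 2 2 - sE (3 * q * l1) (Y 2 0 1) - sE ((q - q^2) * l1) (Y 1 1 0)
     - sE ((q^2 - q) * l112) (Y 1 0 2)"
  "\<gamma> (X 1 2 2) = Y 1 2 2 - sE ((q - q^2) * l1) (Y 2 1 0) - sE ((q^2 - q) * l112) (Y 2 0 2)"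
  and gamma_values_other: "\<And>n2 n12 n1. n2 \<le> 2 \<Longrightarrow> n12 \<le> 2 \<Longrightarrow> n1 \<le> 2 \<Longrightarrow>
    (n2, n12, n1) \<notin> {(0,2,0), (0,2,1), (0,1,2), (1,2,0), (1,1,2), (1,2,1), (0,2,2), (1,2,2)} \<Longrightarrow>
    \<gamma> (X n2 n12 n1) = Y n2 n12 n1"
proof -
  \<comment> \<open>For \<open>a > 2\<close> the value is 0 because \<open>x G2 ^ 3 = 0\<close>,
    although \<open>y G2 ^ 3\<close> is the scalar \<open>l2\<close>. This is why
    \<open>X 1 2 1\<close>, unlike \<open>X 0 2 1\<close>, has no \<open>l1\<close>
    correction.\<close>
  have ell': "\<l> (X a b c) = (if a \<le> 2 then Y a b c else 0)" if "b \<le> 2" "c \<le> 2" for a b c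
    using that ell(3) by (simp add: X_eq_0 linearD[OF ell(1)])
  have neg: "(q - q\<^sup>2) * l1 = - ((q\<^sup>2 - q) * l1)" by (simp add: algebra_simps)
  note simps = linearD[OF ell(1)] ell' neg scale_laws(7,8)[OF spaces(3)] scale_laws(6)[OF spaces(3)]
  show "\<gamma> (X 0 2 0) = Y 0 2 0 - sE ((q^2 - q) * l112) (Y 1 0 0)"
    using gamma_X[of 0 2 0] theta_Y(5)[of 0] by (simp add: simps numeral_2_eq_2[symmetric])
  show "\<gamma> (X 0 2 1) = Y 0 2 1 + sE (3 * q^2 * l1) (Y 2 0 0) - sE ((q^2 - q) * l112) (Y 1 0 1)"
    using gamma_X[of 0 2 1] theta_Y(6)[of 0] by (simp add: simps numeral_2_eq_2[symmetric])
  show "\<gamma> (X 0 1 2) = Y 0 1 2 - sE ((q^2 - q) * l1) (Y 1 0 0)"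
    using gamma_X[of 0 1 2] theta_Y(4)[of 0] by (simp add: simps numeral_2_eq_2[symmetric])
  show "\<gamma> (X 1 2 0) = Y 1 2 0 - sE ((q^2 - q) * l112) (Y 2 0 0)"
    using gamma_X[of 1 2 0] theta_Y(5)[of 1] by (simp add: simps numeral_2_eq_2[symmetric])
  show "\<gamma> (X 1 1 2) = Y 1 1 2 - sE ((q^2 - q) * l1) (Y 2 0 0)"
    using gamma_X[of 1 1 2] theta_Y(4)[of 1] by (simp add: simps numeral_2_eq_2[symmetric])
  show "\<gamma> (X 1 2 1) = Y 1 2 1 - sE ((q^2 - q) * l112) (Y 2 0 1)"
    using gamma_X[of 1 2 1] theta_Y(6)[of 1] by (simp add: simps numeral_2_eq_2[symmetric])
  show "\<gamma> (X 0 2 2) = Y 0 2 2 - sE (3 * q * l1) (Y 2 0 1) - sE ((q - q^2) * l1) (Y 1 1 0)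
     - sE ((q^2 - q) * l112) (Y 1 0 2)"
    using gamma_X[of 0 2 2] theta_Y(7)[of 0] by (simp add: simps numeral_2_eq_2[symmetric])
  show "\<gamma> (X 1 2 2) = Y 1 2 2 - sE ((q - q^2) * l1) (Y 2 1 0) - sE ((q^2 - q) * l112) (Y 2 0 2)"
    using gamma_X[of 1 2 2] theta_Y(7)[of 1] by (simp add: simps numeral_2_eq_2[symmetric])
  fix n2 n12 n1 :: nat
  assume "n2 \<le> 2" "n12 \<le> 2" "n1 \<le> 2"
    "(n2, n12, n1) \<notin> {(0,2,0), (0,2,1), (0,1,2), (1,2,0), (1,1,2), (1,2,1), (0,2,2), (1,2,2)}"
  then have "n12 = 0 \<or> n12 = 1 \<and> n1 = 0 \<or> n12 = 1 \<and> n1 = 1 \<or> n2 = 2 \<and> n12 = 1 \<and> n1 = 2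
    \<or> n2 = 2 \<and> n12 = 2 \<and> n1 = 0 \<or> n2 = 2 \<and> n12 = 2 \<and> n1 = 1 \<or> n2 = 2 \<and> n12 = 2 \<and> n1 = 2"
    unfolding le_2_cases by (elim disjE) simp_all
  then show "\<gamma> (X n2 n12 n1) = Y n2 n12 n1"
    using \<open>n2 \<le> 2\<close> \<open>n1 \<le> 2\<close> gamma_X[of n2 n12 n1] theta_Y[of n2]
    by (elim disjE conjE) (simp_all add: simps)
qed

end

theorem corollary5p2:
  fixes q l1 l2 l12 l112 l122 :: "'k::{alg_closed_field, field_char_0}"
    and H :: "('k, 'h::ring_1) hopf"
    and g :: "gen \<Rightarrow> 'h" and \<chi> :: "gen \<Rightarrow> 'h \<Rightarrow> 'k"
    and actT :: "'h \<Rightarrow> 'k tensor_algebra \<Rightarrow> 'k tensor_algebra"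
    and \<delta>T :: "'k tensor_algebra \<Rightarrow> ('h \<times> 'k tensor_algebra) list"
    and \<Delta>T :: "'k tensor_algebra \<Rightarrow> ('k tensor_algebra \<times> 'k tensor_algebra) list"
    and sB :: "'k \<Rightarrow> 'b::ring_1 \<Rightarrow> 'b" and \<pi>B :: "'k tensor_algebra \<Rightarrow> 'b"
    and actB :: "'h \<Rightarrow> 'b \<Rightarrow> 'b" and \<delta>B :: "'b \<Rightarrow> ('h \<times> 'b) list"
    and \<Delta>B :: "'b \<Rightarrow> ('b \<times> 'b) list" and \<epsilon>B :: "'b \<Rightarrow> 'k"
    and sE :: "'k \<Rightarrow> 'e::ring_1 \<Rightarrow> 'e" and \<pi>E :: "'k tensor_algebra \<Rightarrow> 'e"
    and actE :: "'h \<Rightarrow> 'e \<Rightarrow> 'e" and \<rho> :: "'e \<Rightarrow> ('e \<times> 'b) list"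
    and \<l> :: "'b \<Rightarrow> 'e" and \<epsilon>0 :: "'e \<Rightarrow> 'k"
    and \<tau>2 :: "'k tensor_algebra \<Rightarrow> 'k tensor_algebra"
    and x :: "gen \<Rightarrow> 'b" and y :: "gen \<Rightarrow> 'e"
  assumes q: "q ^ 3 = 1" "\<forall>m. 0 < m \<and> m < 3 \<longrightarrow> q ^ m \<noteq> 1"
    and H: "hopf_algebra H" "semisimple_ring TYPE('h)"
    and realization: "principal_yd_realization H q g \<chi>"
    and lambda:
      "l1 \<noteq> 0 \<longrightarrow> conv_power H (\<chi> G1) 3 = counit H"
      "l2 \<noteq> 0 \<longrightarrow> conv_power H (\<chi> G2) 3 = counit H"
      "l12 \<noteq> 0 \<longrightarrow> conv_power H (conv H (\<chi> G1) (\<chi> G2)) 3 = counit H"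
      "l112 \<noteq> 0 \<longrightarrow> conv H (conv_power H (\<chi> G1) 2) (\<chi> G2) = counit H"
      "l122 \<noteq> 0 \<longrightarrow> conv H (\<chi> G1) (conv_power H (\<chi> G2) 2) = counit H"
    and TV: "yd_algebra H tscale actT \<delta>T"
      "\<forall>i h. actT h (tgen i) = tscale (\<chi> i h) (tgen i)"
      "\<forall>i. tensor_eq (scal H) tscale (\<delta>T (tgen i)) [(g i, tgen i)]"
      "braided_algebra_map tscale tscale tscale actT \<delta>T \<Delta>T"
      "\<forall>i. tensor_eq tscale tscale (\<Delta>T (tgen i)) [(tgen i, 1), (1, tgen i)]"
    and B: "presented_by sB \<pi>B (relators q 0 0 0 0 0)" "\<forall>i. x i = \<pi>B (tgen i)"
      "yd_algebra H sB actB \<delta>B"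
      "\<forall>i h. actB h (x i) = sB (\<chi> i h) (x i)"
      "\<forall>i. tensor_eq (scal H) sB (\<delta>B (x i)) [(g i, x i)]"
      "braided_algebra_map sB sB sB actB \<delta>B \<Delta>B"
      "\<forall>i. tensor_eq sB sB (\<Delta>B (x i)) [(x i, 1), (1, x i)]"
      "algebra_map sB (*) \<epsilon>B" "\<forall>i. \<epsilon>B (x i) = 0"
    and E: "presented_by sE \<pi>E (relators q l1 l2 l12 l112 l122)" "\<forall>i. y i = \<pi>E (tgen i)"
      "module_algebra H sE actE"
      "\<forall>i h. actE h (y i) = sE (\<chi> i h) (y i)"
      "braided_algebra_map sE sE sB actE \<delta>B \<rho>"
      "\<forall>i. tensor_eq sE sB (\<rho> (y i)) [(y i, 1), (1, x i)]"
    and ell: "Vector_Spaces.linear sB sE \<l>" "bij \<l>"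
      "\<forall>n2\<le>2. \<forall>n12\<le>2. \<forall>n1\<le>2. \<l> (pbw sB q x n2 n12 n1) = pbw sE q y n2 n12 n1"
    and eps0: "Vector_Spaces.linear sE (*) \<epsilon>0" "\<epsilon>0 \<circ> \<l> = \<epsilon>B"
    and tau2: "projection_onto_along tscale \<tau>2 {t. \<pi>B t = 0}
      (module.span tscale {pbw tscale q tgen n2 n12 n1 | n2 n12 n1. n2 \<le> 2 \<and> n12 \<le> 2 \<and> n1 \<le> 2})"
  shows
    "let X = pbw sB q x;
         Y = pbw sE q y;
         is_gamma = (\<lambda>\<gamma>. Vector_Spaces.linear sB sE \<gamma> \<and>
           (\<forall>n2\<le>2. \<forall>n12\<le>2. \<forall>n1\<le>2.
              \<gamma> (X n2 n12 n1) = Y n2 n12 n1 -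
                tensor_lift (\<lambda>c e. sE c e)
                  (tensor_map \<epsilon>0 \<l>
                    (tensor_map (\<pi>E \<circ> \<tau>2) \<pi>B
                      (reduced_comult \<Delta>T (pbw tscale q tgen n2 n12 n1))))))
     in (\<exists>!\<gamma>. is_gamma \<gamma>) \<and>
        (\<forall>\<gamma>. is_gamma \<gamma> \<longrightarrow>
           is_section sB actB \<Delta>B \<epsilon>B sE actE \<rho> \<gamma> \<and>
           \<epsilon>0 \<circ> \<gamma> = \<epsilon>B \<and>
           \<gamma> (X 0 2 0) = Y 0 2 0 - sE ((q^2 - q) * l112) (Y 1 0 0) \<and>
           \<gamma> (X 0 2 1) = Y 0 2 1 + sE (3 * q^2 * l1) (Y 2 0 0) - sE ((q^2 - q) * l112) (Y 1 0 1) \<and>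
           \<gamma> (X 0 1 2) = Y 0 1 2 - sE ((q^2 - q) * l1) (Y 1 0 0) \<and>
           \<gamma> (X 1 2 0) = Y 1 2 0 - sE ((q^2 - q) * l112) (Y 2 0 0) \<and>
           \<gamma> (X 1 1 2) = Y 1 1 2 - sE ((q^2 - q) * l1) (Y 2 0 0) \<and>
           \<gamma> (X 1 2 1) = Y 1 2 1 - sE ((q^2 - q) * l112) (Y 2 0 1) \<and>
           \<gamma> (X 0 2 2) = Y 0 2 2 - sE (3 * q * l1) (Y 2 0 1) - sE ((q - q^2) * l1) (Y 1 1 0)
                           - sE ((q^2 - q) * l112) (Y 1 0 2) \<and>
           \<gamma> (X 1 2 2) = Y 1 2 2 - sE ((q - q^2) * l1) (Y 2 1 0)
                           - sE ((q^2 - q) * l112) (Y 2 0 2) \<and>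
           (\<forall>n2\<le>2. \<forall>n12\<le>2. \<forall>n1\<le>2.
              (n2, n12, n1) \<notin> {(0,2,0), (0,2,1), (0,1,2), (1,2,0), (1,1,2), (1,2,1), (0,2,2), (1,2,2)}
              \<longrightarrow> \<gamma> (X n2 n12 n1) = Y n2 n12 n1))"
proof -
  have "q \<noteq> 1" using q(2)[rule_format, of 1] by simp
  then interpret cleft_setting q l1 l2 l12 l112 l122 H g \<chi> actT \<delta>T \<Delta>T sB \<pi>B actB \<delta>B \<Delta>B \<epsilon>B
    sE \<pi>E actE \<rho> \<l> \<epsilon>0 \<tau>2 x y
    using q(1) H(1) realization lambda(1,4) TV B E ell eps0 tau2 by (intro cleft_setting.intro)
  define is_gamma where "is_gamma f \<longleftrightarrow> Vector_Spaces.linear sB sE f \<and>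
    (\<forall>n2\<le>2. \<forall>n12\<le>2. \<forall>n1\<le>2. f (X n2 n12 n1) = Y n2 n12 n1 -
      tensor_lift (\<lambda>c e. sE c e) (tensor_map \<epsilon>0 \<l> (tensor_map (\<pi>E \<circ> \<tau>2) \<pi>B
        (reduced_comult \<Delta>T (pbw tscale q tgen n2 n12 n1)))))" for f
  have "is_gamma \<gamma>" using gamma_linear gamma_formula by (simp add: is_gamma_def)
  have unique: "f = \<gamma>" if "is_gamma f" for f
    by (rule linear_eq_on_pbw[where s = sE])
      (use that \<open>is_gamma \<gamma>\<close> in \<open>simp_all add: is_gamma_def\<close>)
  \<comment> \<open>The formula prescribes a linear map on a spanning set, so it characterizes
    \<open>\<gamma>\<close>; uniqueness and the statement about all solutions both reduce to facts
    about \<open>\<gamma>\<close>.\<close>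
  then have iff: "is_gamma f \<longleftrightarrow> f = \<gamma>" for f using \<open>is_gamma \<gamma>\<close> by blast
  have counit: "\<epsilon>0 \<circ> \<gamma> = \<epsilon>B" by (simp add: fun_eq_iff eps0_gamma)
  show ?thesis
    unfolding Let_def is_gamma_def[symmetric] iff
    by (intro conjI ex1I[of _ \<gamma>] allI impI; hypsubst?)
      (assumption | rule HOL.refl gamma_section counit gamma_values gamma_values_other)+
qed

end
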